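(* Let $p$ be an odd prime, let $\mathbf{C}^{(p)}=(c_i)_{i\ge 0}$ be the $p$-Cantor sequence over $\mathbb{F}_p$, and extend it to the doubly infinite sequence $\mathbf{C}^{(p,L)}=(c_i)_{i\in\mathbb{Z}}$ by setting $c_i=0$ for $i<0$. Let $W=W_p(\mathbf{C}^{(p,L)})$ be its number wall over $\mathbb{F}_p$. Then \[\big(\chi(W)[m,n]\big)_{m,n\ge 0}=\Pi\big(\Phi_p^\infty(A)\big),\] where $\Phi_p$, $\Pi$, $A$ are as described in the context.
   Context: Notation: $p_2=(p-1)/2$. For real $a,b$, $\binom{a}{b}=\frac{a!}{b!(a-b)!}$ if $a,b$ are nonnegative integers with $a\ge b$, and $\binom{a}{b}=0$ otherwise. The $p$-Cantor sequence: let $\phi_p$ be the substitution on the alphabet $\{0,1,\dots,p-1\}$ (identified with $\mathbb{F}_p$) sending each letter $n$ to the word of length $p$ whose $i$-th letter ($0\le i\le p-1$) is $n\binom{p_2}{i/2}\bmod p$, extended to words by concatenation; $\mathbf{C}^{(p)}=(c_i)_{i\ge0}=\lim_{k\to\infty}\phi_p^k(1)$ (the fixed point of $\phi_p$ beginning with $1$). Number wall: for a doubly infinite sequence $\mathbf{S}=(s_i)_{i\in\mathbb{Z}}$ over $\mathbb{F}_p$, $W_p(\mathbf{S})[m,n]=\det\big((s_{i-j+n})_{0\le i,j\le m}\big)$ for $m\ge0$, $W_p(\mathbf{S})[m,n]=1$ for $m=-1$ and $0$ for $m<-1$ ($m$ is the row index, $n$ the column index). The profile $\chi(W)$ is the array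 with $\chi(W)[m,n]=0$ if $W[m,n]=0$ and $\chi(W)[m,n]=X$ otherwise, where $X$ is a fixed symbol. Alphabet $\mathcal{A}=\{A,B,F,0,E_N,E_E,E_S,E_W,C_{NE},C_{SE},C_{SW},C_{NW}\}$. $\Phi_p$ is the two-dimensional $[p,p]$-morphism: each letter is sent to a $p\times p$ array (entries indexed by $0\le m,n\le p-1$, $m$ = row, $n$ = column), and an array of letters is sent to the block array obtained by replacing each letter by its image. The images are: - $\Phi_p(A)_{m,n}$ is $A$ if $m,n$ both even; $0$ if $m$ even, $n$ odd; $F$ if $m$ odd, $n$ even; $B$ if $m,n$ both odd. - $\Phi_p(B)_{m,n}$ is $B$ if $m,n$ both even; $F$ if $m$ even, $n$ odd; $0$ if $m$ odd, $n$ even; $A$ if $m,n$ both odd. - $\Phi_p(0)$ is the all-$0$ array. - $\Phi_p(F)$: $C_{NW}$ at $(0,0)$, $C_{NE}$ at $(0,p-1)$, $C_{SW}$ at $(p-1,0)$, $C_{SE}$ at $(p-1,p-1)$; $E_N$ at $(0,n)$, $E_S$ at $(p-1,n)$ for $0<n<p-1$; $E_W$ at $(m,0)$, $E_E$ at $(m,p-1)$ for $0<m<p-1$; $0$ elsewhere. - $\Phi_p(E_N)$: $E_N$ on row $0$, $0$ elsewhere; $\Phi_p(E_S)$: $E_S$ on row $p-1$, $0$ elsewhere; $\Phi_p(E_E)$: $E_E$ on column $p-1$, $0$ elsewhere; $\Phi_p(E_W)$: $E_W$ on column $0$, $0$ elsewhere. - $\Phi_p(C_{NW})$: $C_{NW}$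 at $(0,0)$, $E_N$ at $(0,n)$ for $n\neq0$, $E_W$ at $(m,0)$ for $m\ne0$, $0$ elsewhere. - $\Phi_p(C_{NE})$: $C_{NE}$ at $(0,p-1)$, $E_N$ at $(0,n)$ for $n\ne p-1$, $E_E$ at $(m,p-1)$ for $m\ne0$, $0$ elsewhere. - $\Phi_p(C_{SE})$: $C_{SE}$ at $(p-1,p-1)$, $E_S$ at $(p-1,n)$ for $n\ne p-1$, $E_E$ at $(m,p-1)$ for $m\ne p-1$, $0$ elsewhere. - $\Phi_p(C_{SW})$: $C_{SW}$ at $(p-1,0)$, $E_S$ at $(p-1,n)$ for $n\ne0$, $E_W$ at $(m,0)$ for $m\ne p-1$, $0$ elsewhere. Since $\Phi_p(A)_{0,0}=A$, the arrays $\Phi_p^k(A)$ ($p^k\times p^k$) are each the top-left block of the next, and $\Phi_p^\infty(A)$ is their limit, an infinite array indexed by $m,n\ge0$. $\Pi$ is the letter-by-letter coding $\Pi(0)=0$ and $\Pi(L)=X$ for every letter $L\ne 0$. *)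

theory Defs
  imports
    Complex_Main
    "Jordan_Normal_Form.Determinant"
    "Berlekamp_Zassenhaus.Finite_Field"
begin

section \<open>The Cantor sequence\<close>

definition binom :: "real \<Rightarrow> real \<Rightarrow> nat" where
  "binom a b = (if a \<in> \<nat> \<and> b \<in> \<nat> \<and> b \<le> a then nat \<lfloor>a\<rfloor> choose nat \<lfloor>b\<rfloor> else 0)"

text \<open>The field with $p$ elements is the type \<open>'p mod_ring\<close> with \<open>p = CARD('p)\<close>, and its elements
  serve as the letters $0, \dots, p-1$. Multiplication in the type performs the reduction
  modulo $p$.\<close>

definition cantor_letter :: "'p::prime_card mod_ring \<Rightarrow> 'p mod_ring list" where
  "cantor_letter n =
     map (\<lambda>i. n * of_nat (binom ((real CARD('p) - 1) / 2) (real i / 2))) [0..<CARD('p)]"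

definition cantor_subst :: "'p::prime_card mod_ring list \<Rightarrow> 'p mod_ring list" where
  "cantor_subst w = concat (map cantor_letter w)"

text \<open>The limit of the words \<open>(cantor_subst ^^ k) [1]\<close>, letter by letter:
  the value on which the letter at position \<open>i\<close> (which exists for all large \<open>k\<close>) is
  eventually constant. That such a value exists for odd \<open>p\<close> is \<open>cantor_seq_eq\<close> below.\<close>

definition cantor_seq :: "nat \<Rightarrow> 'p::prime_card mod_ring" where
  "cantor_seq i = (THE x :: 'p mod_ring. \<forall>\<^sub>F k in sequentially.
     i < length ((cantor_subst ^^ k) [1 :: 'p mod_ring]) \<and> (cantor_subst ^^ k) [1] ! i = x)"

definition extend_zero :: "(nat \<Rightarrow> 'a::zero) \<Rightarrow> int \<Rightarrow> 'a" where
  "extend_zero s i = (if i < 0 then 0 else s (nat i))"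


section \<open>Number walls and profiles\<close>

definition number_wall :: "(int \<Rightarrow> 'a::comm_ring_1) \<Rightarrow> int \<Rightarrow> int \<Rightarrow> 'a" where
  "number_wall s m n =
     (if m < -1 then 0
      else if m = -1 then 1
      else det (mat (nat (m + 1)) (nat (m + 1)) (\<lambda>(i, j). s (int i - int j + n))))"

datatype profile_symbol = Zero | X

definition profile :: "(int \<Rightarrow> int \<Rightarrow> 'a::zero) \<Rightarrow> int \<Rightarrow> int \<Rightarrow> profile_symbol" where
  "profile W m n = (if W m n = 0 then Zero else X)"


section \<open>The two-dimensional morphism\<close>

datatype letter =
    LA | LB | LF | L0
  | EN | EE | ES | EW
  | CNE | CSE | CSW | CNW

fun Phi_entry :: "nat \<Rightarrow> letter \<Rightarrow> nat \<Rightarrow> nat \<Rightarrow> letter" where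
  "Phi_entry p LA m n =
     (if even m then (if even n then LA else L0) else (if even n then LF else LB))"
| "Phi_entry p LB m n =
     (if even m then (if even n then LB else LF) else (if even n then L0 else LA))"
| "Phi_entry p L0 m n = L0"
| "Phi_entry p LF m n =
     (if m = 0 \<and> n = 0 then CNW
      else if m = 0 \<and> n = p - 1 then CNE
      else if m = p - 1 \<and> n = 0 then CSW
      else if m = p - 1 \<and> n = p - 1 then CSE
      else if m = 0 then EN
      else if m = p - 1 then ES
      else if n = 0 then EW
      else if n = p - 1 then EE
      else L0)"
| "Phi_entry p EN m n = (if m = 0 then EN else L0)"
| "Phi_entry p ES m n = (if m = p - 1 then ES else L0)"
| "Phi_entry p EE m n = (if n = p - 1 then EE else L0)"
| "Phi_entry p EW m n = (if n = 0 then EW else L0)"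
| "Phi_entry p CNW m n =
     (if m = 0 \<and> n = 0 then CNW else if m = 0 then EN else if n = 0 then EW else L0)"
| "Phi_entry p CNE m n =
     (if m = 0 \<and> n = p - 1 then CNE else if m = 0 then EN else if n = p - 1 then EE else L0)"
| "Phi_entry p CSE m n =
     (if m = p - 1 \<and> n = p - 1 then CSE else if m = p - 1 then ES
      else if n = p - 1 then EE else L0)"
| "Phi_entry p CSW m n =
     (if m = p - 1 \<and> n = 0 then CSW else if m = p - 1 then ES else if n = 0 then EW else L0)"

definition Phi_letter :: "nat \<Rightarrow> letter \<Rightarrow> letter mat" where
  "Phi_letter p L = mat p p (\<lambda>(m, n). Phi_entry p L m n)"

definition Phi :: "nat \<Rightarrow> letter mat \<Rightarrow> letter mat" where
  "Phi p M = mat (p * dim_row M) (p * dim_col M)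
     (\<lambda>(m, n). Phi_letter p (M $$ (m div p, n div p)) $$ (m mod p, n mod p))"

definition Phi_pow :: "nat \<Rightarrow> nat \<Rightarrow> letter \<Rightarrow> letter mat" where
  "Phi_pow p k L = (Phi p ^^ k) (mat 1 1 (\<lambda>_. L))"

text \<open>The limit is taken entry by entry, as for \<open>cantor_seq\<close>; see \<open>Phi_limit_A_eq\<close>.\<close>

definition Phi_limit :: "nat \<Rightarrow> letter \<Rightarrow> nat \<Rightarrow> nat \<Rightarrow> letter" where
  "Phi_limit p L m n = (THE x. \<forall>\<^sub>F k in sequentially.
     m < dim_row (Phi_pow p k L) \<and> n < dim_col (Phi_pow p k L) \<and> Phi_pow p k L $$ (m, n) = x)"

fun Pi_letter :: "letter \<Rightarrow> profile_symbol" where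
  "Pi_letter L0 = Zero"
| "Pi_letter _ = X"

definition Pi_array :: "(nat \<Rightarrow> nat \<Rightarrow> letter) \<Rightarrow> nat \<Rightarrow> nat \<Rightarrow> profile_symbol" where
  "Pi_array M m n = Pi_letter (M m n)"


section \<open>The limits are well defined\<close>

lemma the_eventually_eq:
  assumes "\<And>k. k \<ge> (K::nat) \<Longrightarrow> D k \<and> f k = v"
  shows "(THE x. \<forall>\<^sub>F k in sequentially. D k \<and> f k = x) = v"
proof (rule the_equality)
  show "\<forall>\<^sub>F k in sequentially. D k \<and> f k = v"
    using assms by (auto simp: eventually_sequentially)
next
  fix x assume "\<forall>\<^sub>F k in sequentially. D k \<and> f k = x"
  then obtain N where "\<forall>k\<ge>N. D k \<and> f k = x"
    by (auto simp: eventually_sequentially)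
  with assms[of "max K N"] show "x = v" by auto
qed

lemma length_cantor_letter [simp]:
  "length (cantor_letter (n :: 'p::prime_card mod_ring)) = CARD('p)"
  by (simp add: cantor_letter_def)

lemma length_cantor_subst [simp]:
  "length (cantor_subst (w :: 'p::prime_card mod_ring list)) = CARD('p) * length w"
  by (induction w) (auto simp: cantor_subst_def)

lemma cantor_subst_append: "cantor_subst (u @ v) = cantor_subst u @ cantor_subst v"
  by (simp add: cantor_subst_def)

lemma length_cantor_pow:
  "length ((cantor_subst ^^ k) (w :: 'p::prime_card mod_ring list)) = CARD('p) ^ k * length w"
  by (induction k) auto

lemma cantor_pow_append: "(cantor_subst ^^ k) (u @ v) = (cantor_subst ^^ k) u @ (cantor_subst ^^ k) v"
  by (induction k) (auto simp: cantor_subst_append)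

lemma cantor_subst_one:
  assumes "odd CARD('p::prime_card)"
  shows "\<exists>v. cantor_subst [1 :: 'p mod_ring] = [1] @ v"
proof -
  have "(real CARD('p) - 1) / 2 = real ((CARD('p) - 1) div 2)"
    using assms by (auto elim!: oddE)
  then have "(real CARD('p) - 1) / 2 \<in> \<nat>" by simp
  then have "hd (cantor_letter (1 :: 'p mod_ring)) = 1"
    by (auto simp: cantor_letter_def hd_map binom_def)
  moreover have "cantor_letter (1 :: 'p mod_ring) \<noteq> []"
    by (auto simp: cantor_letter_def)
  ultimately show ?thesis
    by (cases "cantor_letter (1 :: 'p mod_ring)") (auto simp: cantor_subst_def)
qed

lemma cantor_pow_prefix:
  assumes "odd CARD('p::prime_card)"
  shows "\<exists>v. (cantor_subst ^^ (k + d)) [1 :: 'p mod_ring] = (cantor_subst ^^ k) [1] @ v"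
proof (induction d)
  case (Suc d)
  obtain u where u: "cantor_subst [1 :: 'p mod_ring] = [1] @ u"
    using cantor_subst_one[OF assms] by blast
  have "(cantor_subst ^^ (k + Suc d)) [1 :: 'p mod_ring]
      = (cantor_subst ^^ (k + d)) (cantor_subst [1])"
    by (simp add: funpow_swap1)
  also have "\<dots> = (cantor_subst ^^ (k + d)) [1] @ (cantor_subst ^^ (k + d)) u"
    unfolding u by (rule cantor_pow_append)
  finally show ?case using Suc by auto
qed simp

lemma cantor_seq_eq:
  assumes "odd CARD('p::prime_card)" "i < CARD('p) ^ k"
  shows "(cantor_seq i :: 'p mod_ring) = (cantor_subst ^^ k) [1] ! i"
  unfolding cantor_seq_def
proof (rule the_eventually_eq[where K = k])
  fix l assume "k \<le> l"
  then obtain d where d: "l = k + d" using le_Suc_ex by blast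
  obtain v where v: "(cantor_subst ^^ l) [1 :: 'p mod_ring] = (cantor_subst ^^ k) [1] @ v"
    using cantor_pow_prefix[OF assms(1)] d by blast
  show "i < length ((cantor_subst ^^ l) [1 :: 'p mod_ring]) \<and>
      (cantor_subst ^^ l) [1 :: 'p mod_ring] ! i = (cantor_subst ^^ k) [1] ! i"
    unfolding v using assms by (simp add: length_cantor_pow nth_append)
qed

lemma dim_Phi_pow [simp]:
  "dim_row (Phi_pow p k L) = p ^ k" "dim_col (Phi_pow p k L) = p ^ k"
  by (induction k) (auto simp: Phi_pow_def Phi_def)

lemma Phi_pow_Suc: "Phi_pow p (Suc k) L = Phi p (Phi_pow p k L)"
  by (simp add: Phi_pow_def)

lemma Phi_pow_Suc_index:
  assumes "m < p ^ Suc k" "n < p ^ Suc k"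
  shows "Phi_pow p (Suc k) L $$ (m, n) =
    Phi_entry p (Phi_pow p k L $$ (m div p, n div p)) (m mod p) (n mod p)"
proof -
  have "p > 0" using assms by (cases p) auto
  then show ?thesis
    using assms by (simp add: Phi_pow_Suc Phi_def Phi_letter_def)
qed

lemma Phi_pow_A_step:
  assumes "m < p ^ k" "n < p ^ k" "p > 0"
  shows "Phi_pow p (Suc k) LA $$ (m, n) = Phi_pow p k LA $$ (m, n)"
  using assms
proof (induction k arbitrary: m n)
  case 0
  then show ?case by (simp add: Phi_pow_Suc_index) (simp add: Phi_pow_def)
next
  case (Suc k)
  have d: "m div p < p ^ k" "n div p < p ^ k"
    using Suc.prems by (auto simp: less_mult_imp_div_less mult.commute)
  have b: "m < p ^ Suc (Suc k)" "n < p ^ Suc (Suc k)"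
    using Suc.prems by (auto intro: order_less_le_trans)
  show ?case
    using Suc.IH[OF d] Suc.prems
    by (simp only: Phi_pow_Suc_index[OF b] Phi_pow_Suc_index[OF Suc.prems(1,2)])
qed

lemma Phi_limit_A_eq:
  assumes "m < p ^ k" "n < p ^ k" "p > 0"
  shows "Phi_limit p LA m n = Phi_pow p k LA $$ (m, n)"
proof -
  have "m < p ^ (k + d) \<and> n < p ^ (k + d) \<and>
      Phi_pow p (k + d) LA $$ (m, n) = Phi_pow p k LA $$ (m, n)" for d
  proof (induction d)
    case (Suc d)
    then have "m < p ^ Suc (k + d)" "n < p ^ Suc (k + d)"
      using assms(3) by (auto intro: order_less_le_trans)
    with Suc show ?case using Phi_pow_A_step[of m p "k + d" n] assms(3) by simp
  qed (use assms in auto)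
  then show ?thesis
    unfolding Phi_limit_def conj_assoc[symmetric]
    by (intro the_eventually_eq[where K = k]) (metis dim_Phi_pow le_Suc_ex)
qed

end

theory Submission
  imports Defs
begin

text \<open>
  Put $a = (p^N - 1)/2$. The first $p^N$ terms of the Cantor sequence are the coefficients of
  $(1 + x^2)^a$ modulo $p$, by Lucas' congruence. Sorting rows and columns by parity splits each
  entry of the wall into Toeplitz determinants
  $G = \det \bigl(\binom{a}{r + i - j}\bigr)_{i, j < k}$ (or makes it $0$), and over the integers
  $G \prod_{i < r, j < k} (i + j + 1) = \prod_{i < r, j < k} (a - i + j)$.
  So the $p$-adic valuation of $G$ is a sum over $t$ of differences of numbers of multiples of
  $p^t$. Each difference is nonnegative, depends only on $k$ and $r$ modulo $p^t$, and is positive on an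
  explicit set of residues. Translated back to the wall, these are the sites where the morphism
  writes $0$ below a letter $0$ or $F$ occurring $t$ steps earlier.
\<close>

section \<open>Zeros of the substituted array\<close>

text \<open>In the first case the block of side \<open>q\<close> containing \<open>(m, n)\<close> has parities for which an
  \<open>LA\<close>/\<open>LB\<close> parent yields \<open>L0\<close>; in the second it yields \<open>LF\<close>, and \<open>(m, n)\<close> is not on the frame
  of the block. Parities along the path from the root need not be tracked: on the frame of an
  \<open>LF\<close> block no smaller scale vanishes.\<close>

definition vanishing :: "nat \<Rightarrow> nat \<Rightarrow> nat \<Rightarrow> bool" where
  "vanishing q m n \<longleftrightarrow> even (m div q) \<and> odd (n div q) \<or>
     odd (m div q) \<and> even (n div q) \<and>
       0 < m mod q \<and> m mod q < q - 1 \<and> 0 < n mod q \<and> n mod q < q - 1"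

section \<open>Iterated images of the frame, edge, corner and zero letters\<close>

lemma eq_mult_minus_one_iff:
  assumes "p > 0" "q > 0"
  shows "(m :: nat) = q * p - 1 \<longleftrightarrow> m div p = q - 1 \<and> m mod p = p - 1"
proof
  obtain p' q' where "p = Suc p'" "q = Suc q'"
    using assms by (auto simp: gr0_conv_Suc)
  moreover assume "m = q * p - 1"
  ultimately have "m = p' + q' * p" "p' < p" "p' = p - 1" "q' = q - 1"
    by simp_all
  note m = this
  have "m div p = q'" "m mod p = p'"
    unfolding m(1) using m(2) by simp_all
  with m show "m div p = q - 1 \<and> m mod p = p - 1"
    by simp
next
  assume "m div p = q - 1 \<and> m mod p = p - 1"
  then have "m = (q - 1) * p + (p - 1)"
    using div_mult_mod_eq[of m p] by simp
  then show "m = q * p - 1"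
    using assms by (cases p; cases q) (auto simp: algebra_simps)
qed

lemma eq_zero_iff_div_mod: "(m :: nat) = 0 \<longleftrightarrow> m div p = 0 \<and> m mod p = 0"
  by (metis add_0 div_mult_mod_eq mod_0 mult_0 div_0)

text \<open>Frames are self-similar, because the first and last indices are recognised digit by
  digit. For \<open>LF\<close> the value \<open>q = 1\<close> must be avoided:
  \<open>Phi_entry 1 LF 0 0\<close> is \<open>CNW\<close>, whose image lacks two sides of the
  frame.\<close>

lemma Phi_entry_mult:
  assumes "p > 1" "q > 0" "L \<noteq> LA" "L \<noteq> LB" "L = LF \<Longrightarrow> q > 1"
  shows "Phi_entry p (Phi_entry q L (m div p) (n div p)) (m mod p) (n mod p) =
         Phi_entry (q * p) L m n"
proof -
  obtain a b c d where abcd: "a = m div p" "b = m mod p" "c = n div p" "d = n mod p" by blast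
  have iff: "m = 0 \<longleftrightarrow> a = 0 \<and> b = 0" "n = 0 \<longleftrightarrow> c = 0 \<and> d = 0"
    "m = q * p - 1 \<longleftrightarrow> a = q - 1 \<and> b = p - 1" "n = q * p - 1 \<longleftrightarrow> c = q - 1 \<and> d = p - 1"
    using eq_mult_minus_one_iff[of p q m] eq_mult_minus_one_iff[of p q n]
     eq_zero_iff_div_mod[of m p] eq_zero_iff_div_mod[of n p] assms(1,2) abcd by simp_all
  have p: "p - 1 \<noteq> 0" "L = LF \<Longrightarrow> q - 1 \<noteq> 0"
    using assms by auto
  show ?thesis
    unfolding abcd[symmetric]
    using assms(3,4) p by (cases L) (simp_all only: Phi_entry.simps iff letter.simps, auto)
qed

lemma Phi_pow_Suc_0: "m < p \<Longrightarrow> n < p \<Longrightarrow> Phi_pow p (Suc 0) L $$ (m, n) = Phi_entry p L m n"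
  by (subst Phi_pow_Suc_index) (auto simp: Phi_pow_def)

lemma Phi_pow_eq_Phi_entry:
  assumes "p > 1" "L \<noteq> LA" "L \<noteq> LB" "L = LF \<Longrightarrow> k > 0" "m < p ^ k" "n < p ^ k"
  shows "Phi_pow p k L $$ (m, n) = Phi_entry (p ^ k) L m n"
  using assms(4-)
proof (induction k arbitrary: m n)
  case 0
  then show ?case using assms(2,3) by (cases L) (auto simp: Phi_pow_def)
next
  case (Suc k)
  show ?case
  proof (cases "L = LF \<and> k = 0")
    case True
    then show ?thesis using Suc.prems by (simp add: Phi_pow_Suc_0)
  next
    case False
    have "m div p < p ^ k" "n div p < p ^ k"
      using Suc.prems by (auto simp: less_mult_imp_div_less mult.commute)
    with Suc.IH[of "m div p" "n div p"] False have "Phi_pow p k L $$ (m div p, n div p) =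
        Phi_entry (p ^ k) L (m div p) (n div p)"
      by auto
    moreover have "L = LF \<Longrightarrow> p ^ k > 1"
      using False assms(1) one_less_power[of p k] by simp
    ultimately show ?thesis
      using Suc.prems assms(1-3) Phi_entry_mult[of p "p ^ k" L m n]
      by (simp add: Phi_pow_Suc_index mult.commute)
  qed
qed

text \<open>Unfolds at the root instead of at the leaves: the leading base-\<open>p\<close> digits
  choose the child letter, the remaining ones the position below it. The induction below
  \<open>LA\<close> and \<open>LB\<close> needs this order.\<close>

lemma Phi_pow_Suc_top:
  assumes "m < p ^ Suc k" "n < p ^ Suc k"
  shows "Phi_pow p (Suc k) L $$ (m, n) =
    Phi_pow p k (Phi_entry p L (m div p ^ k) (n div p ^ k)) $$ (m mod p ^ k, n mod p ^ k)"
  using assms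
proof (induction k arbitrary: m n)
  case 0
  then show ?case by (simp add: Phi_pow_Suc_0) (simp add: Phi_pow_def)
next
  case (Suc k)
  have p: "p > 0" using Suc.prems by (cases p) auto
  have digits: "x div p div p ^ k = x div p ^ Suc k" "x div p mod p ^ k = x mod p ^ Suc k div p"
    "x mod p ^ Suc k mod p = x mod p" for x :: nat
    using p by (auto simp: div_mult2_eq mod_mult2_eq mod_mod_cancel)
  have "m div p < p ^ Suc k" "n div p < p ^ Suc k"
    using Suc.prems by (auto simp: less_mult_imp_div_less mult.commute)
  note IH = Suc.IH[OF this]
  have "m mod p ^ Suc k < p ^ Suc k" "n mod p ^ Suc k < p ^ Suc k"
    using p by simp_all
  from Phi_pow_Suc_index[OF this] show ?case
    by (simp only: Phi_pow_Suc_index[OF Suc.prems] IH digits)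
qed

lemma div_mod_add_mult_power:
  fixes p :: nat
  assumes "p > 0" "t \<le> k"
  shows "(m + x * p ^ k) div p ^ t = m div p ^ t + x * p ^ (k - t)"
    and "(m + x * p ^ k) mod p ^ t = m mod p ^ t"
proof -
  have eq: "x * p ^ k = x * p ^ (k - t) * p ^ t"
    using assms(2) by (simp add: power_add[symmetric] mult.assoc)
  then show "(m + x * p ^ k) div p ^ t = m div p ^ t + x * p ^ (k - t)"
    and "(m + x * p ^ k) mod p ^ t = m mod p ^ t"
    unfolding eq using assms(1) by simp_all
qed

text \<open>Moving by \<open>x * p ^ k\<close> adds \<open>x * p ^ (k - t)\<close> to the block
  index at side \<open>p ^ t\<close> and keeps the remainder. As \<open>p\<close> is odd, only the
  parity of \<open>x\<close> matters.\<close>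

lemma vanishing_add_mult_power:
  assumes "odd p" "t \<le> k" "even x = even x'" "even y = even y'"
  shows "vanishing (p ^ t) (m + x * p ^ k) (n + y * p ^ k) =
         vanishing (p ^ t) (m + x' * p ^ k) (n + y' * p ^ k)"
  using assms odd_pos[OF assms(1)] unfolding vanishing_def
  by (simp add: div_mod_add_mult_power)

text \<open>As \<open>p ^ (k - t) - 1\<close> is even, the first and last rows of the block lie in
  odd block rows of side \<open>p ^ t\<close>, its first and last columns in even block columns.
  This excludes the first case of \<open>vanishing\<close>; the remainder \<open>0\<close> or
  \<open>p ^ t - 1\<close> excludes the second.\<close>

lemma not_vanishing_on_frame:
  assumes "odd p" "t < k" "odd x" "even y"
    "m = 0 \<or> m = p ^ k - 1 \<or> n = 0 \<or> n = p ^ k - 1"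
  shows "\<not> vanishing (p ^ t) (m + x * p ^ k) (n + y * p ^ k)"
proof -
  have p: "p > 0" using assms(1) by (rule odd_pos)
  have "p ^ k = p ^ (k - t) * p ^ t"
    using assms(2) by (simp add: power_add[symmetric])
  then have "(p ^ k - 1) div p ^ t = p ^ (k - t) - 1 \<and> (p ^ k - 1) mod p ^ t = p ^ t - 1"
    using eq_mult_minus_one_iff[of "p ^ t" "p ^ (k - t)" "p ^ k - 1"] p by simp
  then have "even ((p ^ k - 1) div p ^ t)" "(p ^ k - 1) mod p ^ t = p ^ t - 1"
    using assms(1) by auto
  then show ?thesis
    using assms p unfolding vanishing_def by (auto simp: div_mod_add_mult_power)
qed

text \<open>The image of \<open>LB\<close> is that of \<open>LA\<close> with both parities flipped,
  so a block below \<open>LB\<close> behaves like one at block position \<open>(1, 1)\<close>. The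
  offset \<open>c\<close> encodes this.\<close>

lemma Phi_pow_AB_eq_L0_iff:
  assumes "odd p" "p > 1" "m < p ^ k" "n < p ^ k"
  shows "Phi_pow p k (if even c then LA else LB) $$ (m, n) = L0 \<longleftrightarrow>
         (\<exists>t<k. vanishing (p ^ t) (m + c * p ^ k) (n + c * p ^ k))"
  using assms(3,4)
proof (induction k arbitrary: m n c)
  case 0
  then show ?case by (simp add: Phi_pow_def)
next
  case (Suc k)
  define Q where "Q = p ^ k"
  have Q: "Q > 0" using assms(2) by (simp add: Q_def)
  define a b m' n' where "a = m div Q" "b = n div Q" "m' = m mod Q" "n' = n mod Q"
  note defs = this
  have lt: "m' < Q" "n' < Q" using Q by (auto simp: defs)
  have shift: "m + c * p ^ Suc k = m' + (a + c * p) * Q" "n + c * p ^ Suc k = n' + (b + c * p) * Q"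
    by (simp_all add: defs Q_def algebra_simps)
  let ?V = "\<lambda>t. vanishing (p ^ t) (m' + (a + c * p) * Q) (n' + (b + c * p) * Q)"
  have top: "?V k \<longleftrightarrow> even (a + c) \<and> odd (b + c) \<or> odd (a + c) \<and> even (b + c) \<and>
      0 < m' \<and> m' < Q - 1 \<and> 0 < n' \<and> n' < Q - 1"
    using Q lt assms(1) by (simp add: vanishing_def Q_def[symmetric])
  have Phi: "Phi_pow p (Suc k) (if even c then LA else LB) $$ (m, n) =
      Phi_pow p k (Phi_entry p (if even c then LA else LB) a b) $$ (m', n')"
    using Phi_pow_Suc_top[OF Suc.prems] by (simp add: defs Q_def)
  \<comment> \<open>Counted with the offset, equal parities give \<open>LA\<close> or
    \<open>LB\<close>, an even row and odd column give \<open>L0\<close>, an odd row and even column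
    give \<open>LF\<close>.\<close>
  consider "even a = even b" | "even (a + c)" "odd (b + c)" | "odd (a + c)" "even (b + c)"
    by auto
  then show ?case
  proof cases
    case 1
    then have "Phi_entry p (if even c then LA else LB) a b =
        (if even (a + c * p) then LA else LB)"
      using assms(1) by auto
    with Phi have "Phi_pow p (Suc k) (if even c then LA else LB) $$ (m, n) = L0 \<longleftrightarrow>
        (\<exists>t<k. vanishing (p ^ t) (m' + (a + c * p) * Q) (n' + (a + c * p) * Q))"
      using Suc.IH[of m' n' "a + c * p"] lt by (simp only: Q_def)
    \<comment> \<open>The induction hypothesis has \<open>a\<close> in the column offset where
      \<open>b\<close> belongs; their parities agree.\<close>
    also have "\<dots> \<longleftrightarrow> (\<exists>t<k. ?V t)"
      unfolding Q_def using assms(1) 1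
      by (intro ex_cong1 conj_cong refl vanishing_add_mult_power) auto
    also have "\<dots> \<longleftrightarrow> (\<exists>t<Suc k. ?V t)"
      using top 1 by (auto simp: less_Suc_eq)
    finally show ?thesis unfolding shift .
  next
    case 2
    then have "Phi_entry p (if even c then LA else LB) a b = L0" by auto
    with Phi have "Phi_pow p (Suc k) (if even c then LA else LB) $$ (m, n) = L0"
      using Phi_pow_eq_Phi_entry[of p L0 k m' n'] assms(2) lt by (simp add: Q_def)
    moreover have "?V k" using top 2 by blast
    ultimately show ?thesis unfolding shift by blast
  next
    case 3
    then have "Phi_entry p (if even c then LA else LB) a b = LF" by auto
    note Phi = Phi[unfolded this]
    have "Phi_pow p k LF $$ (m', n') = L0 \<longleftrightarrow> 0 < m' \<and> m' < Q - 1 \<and> 0 < n' \<and> n' < Q - 1"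
    proof (cases "k = 0")
      case True
      then show ?thesis using lt by (simp add: Phi_pow_def Q_def)
    next
      case False
      then show ?thesis
        using Phi_pow_eq_Phi_entry[of p LF k m' n'] assms(2) lt by (auto simp: Q_def)
    qed
    with top 3 Phi have *: "Phi_pow p (Suc k) (if even c then LA else LB) $$ (m, n) = L0 \<longleftrightarrow> ?V k"
      by auto
    \<comment> \<open>Vanishing at a smaller scale places the site off the frame, so that scale adds
      no zeros to those of scale \<open>p ^ k\<close>.\<close>
    have "?V k" if "t < k" "?V t" for t
      using not_vanishing_on_frame[of p t k "a + c * p" "b + c * p" m' n'] that top lt 3 assms(1)
      unfolding Q_def[symmetric] by fastforce
    with * show ?thesis unfolding shift by (auto simp: less_Suc_eq)
  qed
qed

lemma Phi_limit_eq_L0_iff: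
  assumes "odd p" "p > 1" "m < p ^ k" "n < p ^ k"
  shows "Phi_limit p LA m n = L0 \<longleftrightarrow> (\<exists>t<k. vanishing (p ^ t) m n)"
  using Phi_pow_AB_eq_L0_iff[OF assms, of 0] Phi_limit_A_eq[of m p k n] assms by simp


section \<open>Toeplitz determinants of binomial coefficients\<close>

text \<open>The lower index \<open>r + i - j\<close> of a Toeplitz entry may be negative.\<close>

definition zchoose :: "nat \<Rightarrow> int \<Rightarrow> int" where
  "zchoose n z = (if z < 0 then 0 else int (n choose nat z))"

lemma zchoose_Suc: "zchoose (Suc n) z = zchoose n z + zchoose n (z - 1)"
proof (cases "z \<le> 0")
  case True
  then show ?thesis by (cases "z = 0") (auto simp: zchoose_def)
next
  case False
  then obtain k where "z = int (Suc k)" using zero_less_imp_eq_int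
      by (metis gr0_implies_Suc not_le of_nat_0_less_iff)
  then show ?thesis by (simp add: zchoose_def nat_add_distrib)
qed

text \<open>Pascal's rule for \<open>Suc i choose s\<close> splits the sum into the instances of the
  induction hypothesis at \<open>z + 1\<close> and \<open>z\<close>.\<close>

lemma zchoose_Vandermonde:
  "(\<Sum>s\<le>i. int (i choose s) * zchoose a (z + int s)) = zchoose (a + i) (z + int i)"
proof (induction i arbitrary: a z)
  case (Suc i)
  have "(\<Sum>s\<le>Suc i. int (Suc i choose s) * zchoose a (z + int s)) =
      zchoose a z + (\<Sum>s\<le>i. int (Suc i choose Suc s) * zchoose a (z + int (Suc s)))"
    by (subst sum.atMost_Suc_shift) simp
  also have "(\<Sum>s\<le>i. int (Suc i choose Suc s) * zchoose a (z + int (Suc s))) =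
      (\<Sum>s\<le>i. int (i choose s) * zchoose a (z + 1 + int s)) +
      (\<Sum>s\<le>i. int (i choose Suc s) * zchoose a (z + int (Suc s)))"
    by (simp add: sum.distrib[symmetric] algebra_simps)
  also have "zchoose a z + (\<dots>) = (\<Sum>s\<le>i. int (i choose s) * zchoose a (z + 1 + int s)) +
      (\<Sum>s\<le>Suc i. int (i choose s) * zchoose a (z + int s))"
    by (subst sum.atMost_Suc_shift) simp
  also have "\<dots> = zchoose (a + Suc i) (z + int (Suc i))"
    using Suc.IH[of a "z + 1"] Suc.IH[of a z] by (simp add: zchoose_Suc algebra_simps)
  finally show ?case .
qed simp

lemma zchoose_absorb: "(int (Suc n) - z) * zchoose (Suc n) z = int (Suc n) * zchoose n z"
proof (cases "z < 0")
  case False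
  then obtain k where k: "z = int k" using nonneg_int_cases by (metis not_less)
  show ?thesis
  proof (cases "k \<le> Suc n")
    case True
    have "(Suc n - k) * (Suc n choose k) = Suc n * (n choose k)"
      by (metis binomial_absorb_comp diff_Suc_1)
    then have "int (Suc n - k) * int (Suc n choose k) = int (Suc n) * int (n choose k)"
      by (metis of_nat_mult)
    then show ?thesis using True k by (simp add: zchoose_def of_nat_diff del: binomial_Suc_Suc)
  next
    case False
    then show ?thesis using k by (simp add: zchoose_def binomial_eq_0 del: binomial_Suc_Suc)
  qed
qed (simp add: zchoose_def)

definition binomial_toeplitz :: "nat \<Rightarrow> nat \<Rightarrow> nat \<Rightarrow> int mat" where
  "binomial_toeplitz a k r = mat k k (\<lambda>(i, j). zchoose a (int r + int i - int j))"

text \<open>Left multiplication by the unitriangular Pascal matrix raises the upper index in row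
  \<open>i\<close> from \<open>a\<close> to \<open>a + i\<close>, by Vandermonde. In this form
  absorption separates rows from columns.\<close>

lemma det_binomial_toeplitz_shift:
  "det (binomial_toeplitz a k r) = det (mat k k (\<lambda>(i, j). zchoose (a + i) (int r + int i - int j)))"
proof -
  let ?L = "mat k k (\<lambda>(i, s). int (i choose s))"
  have "?L * binomial_toeplitz a k r = mat k k (\<lambda>(i, j). zchoose (a + i) (int r + int i - int j))"
  proof (rule eq_matI, goal_cases)
    case (1 i j)
    then have "(?L * binomial_toeplitz a k r) $$ (i, j) =
        (\<Sum>s<k. int (i choose s) * zchoose a (int r + int s - int j))"
      by (simp add: binomial_toeplitz_def scalar_prod_def lessThan_atLeast0)
    also have "\<dots> = (\<Sum>s\<le>i. int (i choose s) * zchoose a (int r - int j + int s))"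
      using 1 by (intro sum.mono_neutral_cong_right) (auto simp: algebra_simps)
    also have "\<dots> = zchoose (a + i) (int r - int j + int i)"
      by (rule zchoose_Vandermonde)
    finally show ?case using 1 by (simp add: algebra_simps)
  qed (simp_all add: binomial_toeplitz_def)
  moreover have "det ?L = 1"
    by (subst det_lower_triangular[of k]) (auto simp: prod_list_diag_prod)
  ultimately show ?thesis
    using det_mult[of ?L k "binomial_toeplitz a k r"] by (simp add: binomial_toeplitz_def)
qed

lemma det_mat_diag: "det (mat_diag n f) = (\<Prod>i<n. f i :: 'a :: comm_ring_1)"
  by (subst det_upper_triangular[of _ n])
    (auto simp: prod_list_diag_prod mat_diag_def lessThan_atLeast0)

lemma det_scale_rows:
  fixes f :: "nat \<Rightarrow> 'a :: comm_ring_1"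
  shows "det (mat n n (\<lambda>(i, j). f i * A i j)) = (\<Prod>i<n. f i) * det (mat n n (\<lambda>(i, j). A i j))"
proof -
  have "mat n n (\<lambda>(i, j). f i * A i j) = mat_diag n f * mat n n (\<lambda>(i, j). A i j)"
    by (subst mat_diag_mult_left[of _ n n]) auto
  then show ?thesis by (simp add: det_mult[of _ n] det_mat_diag)
qed

lemma det_scale_columns:
  fixes f :: "nat \<Rightarrow> 'a :: comm_ring_1"
  shows "det (mat n n (\<lambda>(i, j). f j * A i j)) = (\<Prod>j<n. f j) * det (mat n n (\<lambda>(i, j). A i j))"
proof -
  have "mat n n (\<lambda>(i, j). f j * A i j) = mat n n (\<lambda>(i, j). A i j) * mat_diag n f"
    by (subst mat_diag_mult_right[of _ n n]) (auto simp: mult.commute)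
  then show ?thesis by (simp add: det_mult[of _ n] det_mat_diag mult.commute)
qed

text \<open>In the shifted form the two absorption factors are \<open>Suc a - r + j\<close>, which
  depends on the column alone, and \<open>Suc a + i\<close>, which depends on the row alone. Both
  leave the determinant as products.\<close>

lemma det_binomial_toeplitz_Suc:
  "(\<Prod>j<k. int (Suc a) - int r + int j) * det (binomial_toeplitz (Suc a) k r) =
   (\<Prod>i<k. int (Suc a) + int i) * det (binomial_toeplitz a k r)"
proof -
  have "(int (Suc a) - int r + int j) * zchoose (Suc a + i) (int r + int i - int j) =
      (int (Suc a) + int i) * zchoose (a + i) (int r + int i - int j)" for i j
    using zchoose_absorb[of "a + i" "int r + int i - int j"] by (simp add: algebra_simps)
  then show ?thesis
    unfolding det_binomial_toeplitz_shift
      det_scale_rows[of k "\<lambda>i. int (Suc a) + int i", symmetric]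
      det_scale_columns[of k "\<lambda>j. int (Suc a) - int r + int j", symmetric]
    by (simp only: add_Suc_right[symmetric] add_Suc)
qed

text \<open>This is MacMahon's count of plane partitions in an \<open>r\<close> by \<open>k\<close>
  by \<open>a - r\<close> box. Induction on \<open>a\<close> starts at \<open>a = r\<close>, where
  the matrix is upper unitriangular.\<close>

lemma det_binomial_toeplitz:
  assumes "r \<le> a"
  shows "det (binomial_toeplitz a k r) * (\<Prod>i<r. \<Prod>j<k. int (i + j + 1)) =
         (\<Prod>i<r. \<Prod>j<k. int a - int i + int j)"
  using assms
proof (induction a rule: dec_induct)
  case base
  have "det (binomial_toeplitz r k r) = 1"
    by (subst det_upper_triangular[of _ k])
      (auto simp: binomial_toeplitz_def prod_list_diag_prod zchoose_def binomial_eq_0)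
  \<comment> \<open>The rows are read backwards, \<open>i\<close> becoming
    \<open>r - 1 - i\<close>.\<close>
  moreover have "(\<Prod>i<r. \<Prod>j<k. int r - int i + int j) = (\<Prod>i<r. \<Prod>j<k. int (i + j + 1))"
    by (subst prod.nat_diff_reindex[symmetric]) (auto intro!: prod.cong simp: of_nat_diff)
  ultimately show ?case by simp
next
  case (step a)
  define f where "f x = (\<Prod>j<k. x + int j)" for x
  \<comment> \<open>The numerators for \<open>a\<close> and \<open>Suc a\<close> share all row
    products except one at each end.\<close>
  have tele: "(\<Prod>i<l. f (int (Suc a) - int i)) * f (int (Suc a) - int l) =
      f (int (Suc a)) * (\<Prod>i<l. f (int a - int i))" for l
    by (induction l) (simp_all add: algebra_simps)
  have nonzero: "f (int (Suc a) - int r) \<noteq> 0"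
    using step.hyps by (auto simp: f_def)
  have "f (int (Suc a) - int r) * (det (binomial_toeplitz (Suc a) k r) * (\<Prod>i<r. \<Prod>j<k. int (i + j + 1))) =
      f (int (Suc a)) * (det (binomial_toeplitz a k r) * (\<Prod>i<r. \<Prod>j<k. int (i + j + 1)))"
    using det_binomial_toeplitz_Suc[where k = k and a = a and r = r]
    by (simp only: f_def mult.assoc[symmetric])
  also have "\<dots> = f (int (Suc a) - int r) * (\<Prod>i<r. f (int (Suc a) - int i))"
    unfolding step.IH using tele[of r] by (simp only: f_def mult.commute)
  finally have "det (binomial_toeplitz (Suc a) k r) * (\<Prod>i<r. \<Prod>j<k. int (i + j + 1)) =
      (\<Prod>i<r. f (int (Suc a) - int i))"
    unfolding mult_left_cancel[OF nonzero] .
  then show ?case by (simp only: f_def)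
qed


section \<open>Divisibility of the determinants\<close>

text \<open>Multiples of \<open>q\<close> among the numerators minus those among the denominators of the product
  formula: for \<open>a = (p ^ N - 1) div 2\<close> and \<open>q = p ^ t\<close> with \<open>t \<le> N\<close>, \<open>q\<close> divides \<open>a - i + j\<close> iff it
  divides \<open>2 * (i - j) + 1\<close>.\<close>

definition excess :: "nat \<Rightarrow> nat \<Rightarrow> nat \<Rightarrow> int" where
  "excess q k r = (\<Sum>i<r. \<Sum>j<k.
     of_bool (int q dvd 2 * (int i - int j) + 1) - of_bool (int q dvd int (i + j + 1)))"

text \<open>The residues at which \<open>excess\<close> is positive, read off from its closed form
  on one period; \<open>(q - 1) div 2\<close> is the \<open>h\<close> of
  \<open>q = 2 * h + 1\<close>.\<close>

definition excessive :: "nat \<Rightarrow> nat \<Rightarrow> nat \<Rightarrow> bool" where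
  "excessive q k r \<longleftrightarrow>
     0 < k mod q \<and> k mod q \<le> (q - 1) div 2 \<and> (q - 1) div 2 < r mod q \<or>
     (q - 1) div 2 + 1 < k mod q \<and> 0 < r mod q \<and> r mod q < (q - 1) div 2"

section \<open>Periodicity of the excess and its values on one period\<close>

lemma sum_periodic_add:
  fixes f :: "nat \<Rightarrow> 'a :: comm_monoid_add"
  assumes "\<And>j. f (j + q) = f j"
  shows "(\<Sum>j<k + q. f j) = (\<Sum>j<q. f j) + (\<Sum>j<k. f j)"
  using assms by (induction k) (simp_all add: add.assoc)

lemma sum_periodic_mod:
  fixes f :: "nat \<Rightarrow> 'a :: comm_monoid_add"
  assumes "\<And>j. f (j + q) = f j" "(\<Sum>j<q. f j) = 0"
  shows "(\<Sum>j<k. f j) = (\<Sum>j<k mod q. f j)"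
proof -
  have "(\<Sum>j<l + x * q. f j) = (\<Sum>j<l. f j)" for l x
  proof (induction x)
    case (Suc x)
    then show ?case
      using sum_periodic_add[of f q "l + x * q"] assms by (simp add: add_ac)
  qed simp
  from this[of "k mod q" "k div q"] show ?thesis by simp
qed

text \<open>The only contributing index is the residue of \<open>- c\<close> modulo
  \<open>q\<close>.\<close>

lemma sum_complete_residues:
  assumes "q > 0"
  shows "(\<Sum>j<q. of_bool (int q dvd int j + c) :: int) = 1"
proof -
  have "j < q \<and> int q dvd int j + c \<longleftrightarrow> j = nat ((- c) mod int q)" for j
  proof
    assume *: "j < q \<and> int q dvd int j + c"
    then have "int j mod int q = (- c) mod int q"
      unfolding mod_eq_dvd_iff by simp
    moreover have "int j mod int q = int j" using * by simp
    ultimately show "j = nat ((- c) mod int q)" by (metis nat_int)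
  next
    assume "j = nat ((- c) mod int q)"
    then have "int j = (- c) mod int q" using assms by simp
    moreover from this have "int j < int q" using assms by simp
    moreover from calculation have "int j mod int q = (- c) mod int q" by simp
    then have "int q dvd int j + c" unfolding mod_eq_dvd_iff by simp
    ultimately show "j < q \<and> int q dvd int j + c" by simp
  qed
  then have "{..<q} \<inter> {j. int q dvd int j + c} = {nat ((- c) mod int q)}"
    by auto
  then show ?thesis by (simp add: of_bool_def sum.If_cases)
qed

text \<open>Here \<open>2 * x + 1 = 2 * (x - h) + q\<close>, and \<open>2\<close> is invertible
  modulo \<open>q\<close>.\<close>

lemma odd_dvd_double_plus_one_iff:
  assumes "q = 2 * h + 1"
  shows "q dvd 2 * x + 1 \<longleftrightarrow> q dvd x - (h :: int)"
proof -
  have "q dvd 2 * x + 1 \<longleftrightarrow> q dvd 2 * (x - h) + q"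
    using assms by (simp add: algebra_simps)
  also have "\<dots> \<longleftrightarrow> q dvd 2 * (x - h)" by simp
  also have "\<dots> \<longleftrightarrow> q dvd x - h"
    using assms by (intro coprime_dvd_mult_right_iff) simp
  finally show ?thesis .
qed

text \<open>With one index fixed, each of the two divisibility conditions holds for exactly one
  residue of the other index. Their difference therefore sums to zero over a full period, in both
  directions.\<close>

lemma excess_mod:
  assumes "odd q"
  shows "excess q k r = excess q (k mod q) (r mod q)"
proof -
  define e :: "nat \<Rightarrow> nat \<Rightarrow> int" where "e i j =
    of_bool (int q dvd 2 * (int i - int j) + 1) - of_bool (int q dvd int (i + j + 1))" for i j
  obtain h where h: "q = 2 * h + 1" using assms by (elim oddE)
  have "int q = 2 * int h + 1" using h by simp
  note dvd_h = odd_dvd_double_plus_one_iff[OF this]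
  have "int i - int j - int h = int i + (- int j - int h)" for i j by simp
  then have "int q dvd 2 * (int i - int j) + 1 \<longleftrightarrow> int q dvd int i + (- int j - int h)" for i j
    by (simp only: dvd_h)
  moreover have "int (i + j + 1) = int i + (int j + 1)" for i j by simp
  ultimately have e2: "e i j = of_bool (int q dvd int i + (- int j - int h))
      - of_bool (int q dvd int i + (int j + 1))" for i j
    by (simp only: e_def)
  have "int q dvd int i + (- int j - int h) \<longleftrightarrow> int q dvd int j + (int h - int i)" for i j
    using dvd_minus_iff[of "int q" "int i + (- int j - int h)"]
        by (simp only: minus_add_distrib minus_diff_eq minus_minus) (simp add: algebra_simps)
  moreover have "int i + (int j + 1) = int j + (int i + 1)" for i j by simp
  ultimately have e1: "e i j = of_bool (int q dvd int j + (int h - int i))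
      - of_bool (int q dvd int j + (int i + 1))" for i j
    by (simp only: e2)
  have q0: "q > 0" using h by simp
  have "int (x + q) + c = int x + c + int q" for x c by simp
  then have dvd_q: "int q dvd int (x + q) + c \<longleftrightarrow> int q dvd int x + c" for x c
    by (simp only: dvd_add_triv_right_iff)
  have row: "(\<Sum>j<k. e i j) = (\<Sum>j<k mod q. e i j)" for i k
    by (rule sum_periodic_mod)
        (simp_all only: e1 dvd_q sum_subtractf sum_complete_residues[OF q0] diff_self)
  have col: "(\<Sum>i<r. e i j) = (\<Sum>i<r mod q. e i j)" for j r
    by (rule sum_periodic_mod)
        (simp_all only: e2 dvd_q sum_subtractf sum_complete_residues[OF q0] diff_self)
  have "excess q k r = (\<Sum>i<r. \<Sum>j<k mod q. e i j)"
    by (simp only: excess_def row[of _ k] flip: e_def)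
  also have "\<dots> = (\<Sum>j<k mod q. \<Sum>i<r mod q. e i j)"
    by (subst sum.swap) (simp only: col[where r = r])
  also have "\<dots> = excess q (k mod q) (r mod q)"
    by (simp only: excess_def flip: e_def) (rule sum.swap)
  finally show ?thesis .
qed

text \<open>Below \<open>q\<close> the multiples of \<open>q\<close> lie on three lines:
  \<open>i = j + h\<close> and \<open>j = i + h + 1\<close> for the numerators,
  \<open>i + j = 2 * h\<close> for the denominators. The three terms count lattice points of the
  rectangle on them; truncated subtraction gives \<open>0\<close> for an empty intersection.\<close>

lemma excess_small:
  assumes "q = 2 * h + 1" "k < q" "r < q"
  shows "excess q k r =
    int (min r (k + h) - h) + int (min r (k - (h + 1))) - int (r - (q - k))"
proof -
  have hq: "int q = 2 * int h + 1" using assms(1) by simp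
  have 1: "int q dvd 2 * (int i - int j) + 1 \<longleftrightarrow> i = j + h \<or> j = i + h + 1" if "i < q" "j < q" for i j
  proof
    assume "int q dvd 2 * (int i - int j) + 1"
    then have "int q dvd int i - int j - int h"
      by (simp only: odd_dvd_double_plus_one_iff[OF hq])
    then obtain c where c: "int i - int j - int h = int q * c" by (elim dvdE)
    \<comment> \<open>As \<open>i\<close> and \<open>j\<close> are at most \<open>2 * h\<close>, the
      difference \<open>i - j - h\<close> lies between \<open>- 3 * h\<close> and \<open>h\<close>,
      which leaves the quotients \<open>0\<close> and \<open>- 1\<close>.\<close>
    have "int q * (- 2) < int q * c" "int q * c < int q * 1"
      using c that assms(1) by (simp_all add: algebra_simps)
    moreover have "0 < int q" using assms(1) by simp
    ultimately have "c < 1 \<and> - 2 < c" by (metis mult_less_cancel_left_pos)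
    then have "c = 0 \<or> c = - 1" by auto
    then show "i = j + h \<or> j = i + h + 1" using c assms(1) by auto
  next
    assume "i = j + h \<or> j = i + h + 1"
    then show "int q dvd 2 * (int i - int j) + 1"
    proof
      assume "j = i + h + 1"
      then have "2 * (int i - int j) + 1 = - int q" using assms(1) by simp
      then show ?thesis by simp
    next
      assume "i = j + h"
      then have "2 * (int i - int j) + 1 = int q" using assms(1) by simp
      then show ?thesis by simp
    qed
  qed
  have 2: "int q dvd int (i + j + 1) \<longleftrightarrow> i + j = 2 * h" if "i < q" "j < q" for i j
  proof
    assume "int q dvd int (i + j + 1)"
    then have "q dvd i + j + 1" by (simp only: of_nat_dvd_iff)
    then obtain c where c: "i + j + 1 = q * c" by (elim dvdE)
    then have "q * c < q * 2" using that by linarith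
    then have "c < 2" by simp
    moreover have "c \<noteq> 0" using c by (cases c) auto
    ultimately have "c = 1" by simp
    then show "i + j = 2 * h" using c assms(1) by simp
  qed (use assms(1) in \<open>auto intro!: dvdI[of _ _ 1]\<close>)
  have "excess q k r = (\<Sum>i<r. \<Sum>j<k.
      of_bool (i = j + h) + of_bool (j = i + h + 1) - of_bool (i + j = 2 * h))"
    unfolding excess_def using 1 2 assms by (intro sum.cong refl) (auto simp: of_bool_def)
  also have "\<dots> = (\<Sum>i<r. of_bool (h \<le> i \<and> i < k + h) + of_bool (i + h + 1 < k)
      - of_bool (i \<le> 2 * h \<and> 2 * h < k + i))"
  proof (intro sum.cong refl)
    fix i
    have a: "(\<Sum>j<k. of_bool (i = j + h) :: int) = of_bool (h \<le> i \<and> i < k + h)"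
      by (induction k) (auto simp: of_bool_def)
    have b: "(\<Sum>j<k. of_bool (j = i + h + 1) :: int) = of_bool (i + h + 1 < k)"
      by (induction k) (auto simp: of_bool_def)
    have c: "(\<Sum>j<k. of_bool (i + j = 2 * h) :: int) = of_bool (i \<le> 2 * h \<and> 2 * h < k + i)"
      by (induction k) (auto simp: of_bool_def)
    show "(\<Sum>j<k. of_bool (i = j + h) + of_bool (j = i + h + 1) - of_bool (i + j = 2 * h)) =
      (of_bool (h \<le> i \<and> i < k + h) + of_bool (i + h + 1 < k)
      - of_bool (i \<le> 2 * h \<and> 2 * h < k + i) :: int)"
      unfolding sum_subtractf sum.distrib a b c ..
  qed
  also have "\<dots> = int (min r (k + h) - h) + int (min r (k - (h + 1))) - int (r - (q - k))"
  proof -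
    have a: "(\<Sum>i<r. of_bool (h \<le> i \<and> i < k + h) :: int) = int (min r (k + h) - h)"
      by (induction r) (auto simp: of_bool_def min_def)
    have b: "(\<Sum>i<r. of_bool (i + h + 1 < k) :: int) = int (min r (k - (h + 1)))"
      by (induction r) (auto simp: of_bool_def min_def)
    have c: "(\<Sum>i<r. of_bool (i \<le> 2 * h \<and> 2 * h < k + i) :: int) = int (r - (q - k))"
      using assms by (induction r) (auto simp: of_bool_def)
    show ?thesis unfolding sum_subtractf sum.distrib a b c ..
  qed
  finally show ?thesis .
qed

text \<open>After reduction modulo \<open>q\<close> the closed form is piecewise linear, and linear
  arithmetic settles each piece.\<close>

lemma excess_nonneg: "odd q \<Longrightarrow> excess q k r \<ge> 0"
  and excess_pos_iff: "odd q \<Longrightarrow> excess q k r > 0 \<longleftrightarrow> excessive q k r"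
proof -
  assume "odd q"
  then obtain h where h: "q = 2 * h + 1" by (elim oddE)
  obtain k0 r0 where *: "k0 = k mod q" "r0 = r mod q" by blast
  have lt: "k0 < q" "r0 < q" using h by (auto simp: *)
  have half: "(q - 1) div 2 = h" using h by simp
  note eq = excess_mod[OF \<open>odd q\<close>, of k r, folded *, unfolded excess_small[OF h lt]]
  show "excess q k r \<ge> 0"
    unfolding eq using h lt by (auto simp: min_def)
  show "excess q k r > 0 \<longleftrightarrow> excessive q k r"
    unfolding eq excessive_def *[symmetric] half using h lt by (auto simp: min_def)
qed

section \<open>Valuation of the Toeplitz determinants\<close>

text \<open>Legendre's count: the powers \<open>p ^ t\<close> dividing \<open>x\<close> are those
  with \<open>t\<close> up to the multiplicity, and the bound on \<open>x\<close> keeps these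
  exponents below \<open>N\<close>.\<close>

lemma multiplicity_eq_sum:
  assumes "prime p" "x \<noteq> 0" "\<bar>x\<bar> < int p ^ N"
  shows "int (multiplicity (int p) x) = (\<Sum>t\<in>{1..N}. of_bool (int (p ^ t) dvd x))"
proof -
  have p: "int p > 1" using prime_gt_1_nat[OF assms(1)] by simp
  define M where "M = multiplicity (int p) x"
  have iff: "int (p ^ t) dvd x \<longleftrightarrow> t \<le> M" for t
    unfolding M_def of_nat_power using assms(2) p by (intro power_dvd_iff_le_multiplicity) auto
  have "int p ^ M \<le> \<bar>x\<bar>"
    using dvd_imp_le_int[OF assms(2) multiplicity_dvd[of "int p" x]] by (simp add: M_def)
  with assms(3) have "int p ^ M < int p ^ N" by linarith
  then have "M < N" using p by (rule power_less_imp_less_exp[rotated])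
  have "(\<Sum>t\<in>{1..N}. of_bool (int (p ^ t) dvd x) :: int) = (\<Sum>t\<in>{1..M}. 1)"
    unfolding iff using \<open>M < N\<close> by (intro sum.mono_neutral_cong_right) auto
  then show ?thesis by (simp add: M_def)
qed

text \<open>Taking valuations in the product formula and summing over \<open>t\<close> last gives
  the valuation of the determinant as a sum of the values \<open>excess (p ^ t) k r\<close>. None is
  negative, so nothing cancels.\<close>

lemma prime_dvd_det_binomial_toeplitz_iff:
  assumes "prime p" "odd p" "r + k \<le> (p ^ N - 1) div 2"
  shows "int p dvd det (binomial_toeplitz ((p ^ N - 1) div 2) k r) \<longleftrightarrow>
         (\<exists>t\<in>{1..N}. excessive (p ^ t) k r)"
proof -
  define a where "a = (p ^ N - 1) div 2"
  have a2: "int p ^ N = 2 * int a + 1"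
  proof -
    have "odd (p ^ N)" using assms(2) by simp
    then obtain y where "p ^ N = 2 * y + 1" by (elim oddE)
    then show ?thesis by (simp add: a_def flip: of_nat_power)
  qed
  have ra: "r \<le> a" "r + k \<le> a" using assms(3) by (auto simp: a_def)
  define G where "G = det (binomial_toeplitz a k r)"
  let ?\<mu> = "multiplicity (int p)"
  have pr: "prime_elem (int p)" using assms(1) by simp
  have mult_prod: "?\<mu> (\<Prod>i<r. \<Prod>j<k. f i j) = (\<Sum>i<r. \<Sum>j<k. ?\<mu> (f i j))"
    if "\<And>i j. i < r \<Longrightarrow> j < k \<Longrightarrow> f i j \<noteq> 0" for f :: "nat \<Rightarrow> nat \<Rightarrow> int"
    using that pr by (auto simp: prime_elem_multiplicity_prod_distrib image_iff intro!: sum.cong)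
  have det: "G * (\<Prod>i<r. \<Prod>j<k. int (i + j + 1)) = (\<Prod>i<r. \<Prod>j<k. int a - int i + int j)"
    unfolding G_def by (rule det_binomial_toeplitz[OF ra(1)])
  have "(\<Prod>i<r. \<Prod>j<k. int a - int i + int j) \<noteq> 0"
    using ra by auto
  with det have "G \<noteq> 0" by auto
  have "?\<mu> G + ?\<mu> (\<Prod>i<r. \<Prod>j<k. int (i + j + 1)) = ?\<mu> (\<Prod>i<r. \<Prod>j<k. int a - int i + int j)"
    unfolding det[symmetric] using \<open>G \<noteq> 0\<close> pr
        by (intro prime_elem_multiplicity_mult_distrib[symmetric]) auto
  then have "?\<mu> G + (\<Sum>i<r. \<Sum>j<k. ?\<mu> (int (i + j + 1))) = (\<Sum>i<r. \<Sum>j<k. ?\<mu> (int a - int i + int j))"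
    using ra by (subst (asm) (1 2) mult_prod) auto
  then have "int (?\<mu> G)
      = (\<Sum>i<r. \<Sum>j<k. int (?\<mu> (int a - int i + int j)) - int (?\<mu> (int (i + j + 1))))"
    unfolding sum_subtractf of_nat_sum[symmetric] by linarith
  also have "\<dots> = (\<Sum>i<r. \<Sum>j<k. \<Sum>t\<in>{1..N}. of_bool (int (p ^ t) dvd 2 * (int i - int j) + 1)
      - of_bool (int (p ^ t) dvd int (i + j + 1)))"
  proof (intro sum.cong refl)
    fix i j assume ij: "i \<in> {..<r}" "j \<in> {..<k}"
    have "int (p ^ t) dvd int a - int i + int j \<longleftrightarrow> int (p ^ t) dvd 2 * (int i - int j) + 1"
      if "t \<in> {1..N}" for t
    proof -
      \<comment> \<open>Doubling is harmless since \<open>p ^ t\<close> is odd; it turns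
        \<open>a\<close> into \<open>p ^ N - 1\<close>, and \<open>p ^ N\<close> drops out because
        \<open>t \<le> N\<close>.\<close>
      have "int (p ^ t) dvd int a - int i + int j \<longleftrightarrow> int (p ^ t) dvd 2 * (int a - int i + int j)"
        using assms(2) by (intro coprime_dvd_mult_right_iff[symmetric]) simp
      also have "2 * (int a - int i + int j) = int (p ^ N) - (2 * (int i - int j) + 1)"
        using a2 by simp
      also have "int (p ^ t) dvd \<dots> \<longleftrightarrow> int (p ^ t) dvd 2 * (int i - int j) + 1"
        using that by (intro dvd_diff_right_iff) (auto intro: le_imp_power_dvd)
      finally show ?thesis .
    qed
    \<comment> \<open>From \<open>r + k \<le> a\<close> the factors are positive and less than
      \<open>p ^ N = 2 * a + 1\<close>.\<close>
    moreover have "int (?\<mu> (int a - int i + int j))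
        = (\<Sum>t\<in>{1..N}. of_bool (int (p ^ t) dvd int a - int i + int j))"
      using ij ra a2 by (intro multiplicity_eq_sum assms(1)) auto
    moreover have "int (?\<mu> (int (i + j + 1)))
        = (\<Sum>t\<in>{1..N}. of_bool (int (p ^ t) dvd int (i + j + 1)))"
      using ij ra a2 by (intro multiplicity_eq_sum assms(1)) auto
    ultimately show "int (?\<mu> (int a - int i + int j)) - int (?\<mu> (int (i + j + 1))) =
        (\<Sum>t\<in>{1..N}. of_bool (int (p ^ t) dvd 2 * (int i - int j) + 1)
            - of_bool (int (p ^ t) dvd int (i + j + 1)))"
      by (simp add: sum_subtractf)
  qed
  also have "\<dots> = (\<Sum>t\<in>{1..N}. excess (p ^ t) k r)"
    unfolding excess_def by (simp only: sum.swap[where B = "{1..N}"])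
  finally have "?\<mu> G > 0 \<longleftrightarrow> (\<Sum>t\<in>{1..N}. excess (p ^ t) k r) \<noteq> 0"
    by linarith
  also have "\<dots> \<longleftrightarrow> (\<exists>t\<in>{1..N}. excess (p ^ t) k r \<noteq> 0)"
    using assms(2) by (subst sum_nonneg_eq_0_iff) (auto intro: excess_nonneg)
  also have "\<dots> \<longleftrightarrow> (\<exists>t\<in>{1..N}. excessive (p ^ t) k r)"
  proof -
    have "odd (p ^ t)" for t using assms(2) by simp
    then have "excess (p ^ t) k r \<noteq> 0 \<longleftrightarrow> excessive (p ^ t) k r" for t
      using excess_nonneg[of "p ^ t" k r] excess_pos_iff[of "p ^ t" k r] by force
    then show ?thesis by (simp only:)
  qed
  also have "?\<mu> G > 0 \<longleftrightarrow> int p dvd G"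
    using \<open>G \<noteq> 0\<close> pr by (intro multiplicity_gt_zero_iff) (auto dest: prime_elem_not_unit)
  finally show ?thesis unfolding G_def a_def .
qed


section \<open>The Cantor sequence as a binomial sequence\<close>

text \<open>Coefficient form of \<open>(1 + x)^p = 1 + x^p\<close> modulo \<open>p\<close>: in
  Vandermonde's sum only the terms \<open>k = 0\<close> and \<open>k = p\<close> survive.\<close>

lemma mod_ring_choose_add_prime:
  assumes "prime CARD('p::prime_card)"
  shows "(of_nat ((CARD('p) + n) choose z) :: 'p mod_ring) =
    of_nat (n choose z) + (if z < CARD('p) then 0 else of_nat (n choose (z - CARD('p))))"
proof -
  let ?p = "CARD('p)"
  have zero: "(of_nat (?p choose k) :: 'p mod_ring) = 0" if "k \<notin> {0, ?p}" for k
  proof (cases "k < ?p")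
    case True
    with that assms have "?p dvd (?p choose k)" by (intro dvd_choose_prime) auto
    then show ?thesis by (simp add: of_nat_eq_0_iff_char_dvd)
  qed (use that in \<open>simp add: binomial_eq_0\<close>)
  have "?p > 0" by simp
  have "(of_nat ((?p + n) choose z) :: 'p mod_ring) =
      (\<Sum>k\<le>z. of_nat (?p choose k) * of_nat (n choose (z - k)))"
    by (simp flip: vandermonde of_nat_mult of_nat_sum)
  also have "\<dots> = (\<Sum>k\<in>{0, ?p} \<inter> {..z}. of_nat (?p choose k) * of_nat (n choose (z - k)))"
    using zero by (intro sum.mono_neutral_right) auto
  also have "\<dots> = of_nat (n choose z) + (if z < ?p then 0 else of_nat (n choose (z - ?p)))"
    using \<open>?p > 0\<close> by (cases "z < ?p") (auto simp: Int_insert_left)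
  finally show ?thesis .
qed

text \<open>Each induction step splits off one factor \<open>(1 + x)^p\<close>; the two resulting
  terms recombine by Pascal's rule for \<open>Suc a choose m\<close>.\<close>

lemma mod_ring_Lucas:
  assumes "prime CARD('p::prime_card)" "b < CARD('p)" "h < CARD('p)"
  shows "(of_nat ((CARD('p) * a + h) choose (CARD('p) * m + b)) :: 'p mod_ring) =
    of_nat (a choose m) * of_nat (h choose b)"
proof (induction a arbitrary: m)
  case 0
  then show ?case using assms(3) by (cases m) (simp_all add: binomial_eq_0)
next
  case (Suc a)
  have "CARD('p) * Suc a + h = CARD('p) + (CARD('p) * a + h)" by simp
  note step = mod_ring_choose_add_prime[OF assms(1), of "CARD('p) * a + h"
      "CARD('p) * m + b", folded this]
  show ?case
  proof (cases m)
    case 0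
    then show ?thesis using step Suc.IH[of 0] assms(2) by simp
  next
    case (Suc m')
    then have "\<not> CARD('p) * m + b < CARD('p)" "CARD('p) * m + b - CARD('p) = CARD('p) * m' + b"
      by simp_all
    then show ?thesis using step Suc.IH[of m] Suc.IH[of m'] Suc by (simp add: algebra_simps)
  qed
qed

lemma nth_cantor_letter:
  fixes c :: "'p::prime_card mod_ring"
  assumes "odd CARD('p)" "b < CARD('p)"
  shows "cantor_letter c ! b =
    c * (if even b then of_nat (((CARD('p) - 1) div 2) choose (b div 2)) else 0)"
proof -
  define h where "h = (CARD('p) - 1) div 2"
  have h: "(real CARD('p) - 1) / 2 = real h"
    using assms(1) by (auto simp: h_def elim!: oddE)
  have "binom (real h) (real b / 2) = (if even b then h choose (b div 2) else 0)"
  proof (cases "even b")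
    case True
    then have "real b / 2 = real (b div 2)" by (auto elim!: evenE)
    then show ?thesis using True by (simp add: binom_def binomial_eq_0)
  next
    case False
    have "real b / 2 \<notin> \<nat>"
    proof
      assume "real b / 2 \<in> \<nat>"
      then obtain l where "real b / 2 = real l" by (elim Nats_cases)
      then have "real b = real (2 * l)" by simp
      then have "b = 2 * l" by (simp only: of_nat_eq_iff)
      with False show False by simp
    qed
    then show ?thesis using False by (simp add: binom_def)
  qed
  then show ?thesis
    using assms(2) by (simp add: cantor_letter_def h h_def)
qed

lemma nth_cantor_subst:
  fixes w :: "'p::prime_card mod_ring list"
  assumes "i < CARD('p) * length w"
  shows "cantor_subst w ! i = cantor_letter (w ! (i div CARD('p))) ! (i mod CARD('p))"
  using assms
proof (induction w arbitrary: i)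
  case (Cons c w)
  show ?case
  proof (cases "i < CARD('p)")
    case True
    then show ?thesis by (simp add: cantor_subst_def nth_append)
  next
    case False
    then obtain j where "i = j + CARD('p)" using le_Suc_ex[of "CARD('p)" i]
        by (auto simp: add.commute)
    then show ?thesis
      using Cons.IH[of j] Cons.prems by (simp add: cantor_subst_def nth_append)
  qed
qed simp

text \<open>The half \<open>(p ^ Suc N - 1) div 2\<close> is \<open>p * a + h\<close>, so its last
  base-\<open>p\<close> digit is \<open>h\<close> and Lucas matches one application of the
  substitution.\<close>

lemma nth_cantor_pow:
  assumes "prime CARD('p::prime_card)" "odd CARD('p)" "i < CARD('p) ^ N"
  shows "(cantor_subst ^^ N) [1 :: 'p mod_ring] ! i =
    (if even i then of_nat (((CARD('p) ^ N - 1) div 2) choose (i div 2)) else 0)"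
  using assms(3)
proof (induction N arbitrary: i)
  case (Suc N)
  define p where "p = CARD('p)"
  obtain h where h: "p = 2 * h + 1" using assms(2) by (auto simp: p_def elim: oddE)
  obtain a where a: "p ^ N = 2 * a + 1"
    using assms(2) by (metis p_def even_power oddE)
  have half: "(p - 1) div 2 = h" "(p ^ N - 1) div 2 = a" "(p ^ Suc N - 1) div 2 = p * a + h"
    using a by (simp_all add: h algebra_simps)
  define n b where "n = i div p" "b = i mod p"
  have "p > 0" using h by simp
  then have i: "i = p * n + b" "b < p" by (simp_all add: n_b_def)
  have n: "n < p ^ N" using Suc.prems
      by (simp add: n_b_def p_def less_mult_imp_div_less mult.commute)
  have "(cantor_subst ^^ Suc N) [1 :: 'p mod_ring] ! i =
      (if even n then of_nat (a choose (n div 2)) else 0) *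
      (if even b then of_nat (h choose (b div 2)) else 0)"
  proof -
    have "(cantor_subst ^^ Suc N) [1 :: 'p mod_ring] ! i =
        cantor_letter ((cantor_subst ^^ N) [1] ! n) ! b"
      using Suc.prems by (simp add: nth_cantor_subst length_cantor_pow n_b_def p_def)
    moreover have "(cantor_subst ^^ N) [1 :: 'p mod_ring] ! n =
        (if even n then of_nat (a choose (n div 2)) else 0)"
      using Suc.IH[of n] n unfolding p_def[symmetric] half(2) by simp
    moreover have "cantor_letter c ! b = c * (if even b then of_nat (h choose (b div 2)) else 0)"
      for c :: "'p mod_ring"
      using nth_cantor_letter[OF assms(2), of b c] i(2) unfolding p_def[symmetric] half(1) by simp
    ultimately show ?thesis by simp
  qed
  also have "\<dots> = (if even i then of_nat ((p * a + h) choose (i div 2)) else 0)"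
  proof (cases "even i")
    case False
    then show ?thesis using i h by auto
  next
    case True
    show ?thesis
    proof (cases "even n")
      case even_n: True
      then obtain x where x: "n = 2 * x" by (elim evenE)
      then obtain y where "b = 2 * y" using True i by (auto elim: evenE)
      with x i have "i div 2 = p * x + y" "y < p" by simp_all
      then show ?thesis
        using mod_ring_Lucas[OF assms(1), of y h a x] True x \<open>b = 2 * y\<close> h
        by (simp flip: p_def)
    next
      case False
      then obtain x where x: "n = 2 * x + 1" by (elim oddE)
      then obtain y where y: "b = 2 * y + 1" using True i h by (auto elim: oddE)
      \<comment> \<open>Two odd digits produce a carry: the last digit of \<open>i div 2\<close> is
        \<open>h + y + 1\<close>, which exceeds \<open>h\<close>. So Lucas gives \<open>0\<close>,
        as does the substitution at odd \<open>n\<close>.\<close>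
      with x i h have "i = 2 * (p * x + (h + y + 1))" "h + y + 1 < p"
          by (simp_all add: algebra_simps)
      then have "i div 2 = p * x + (h + y + 1)" "h + y + 1 < p" "h < p" using h by simp_all
      moreover from this have "(of_nat ((p * a + h) choose (p * x + (h + y + 1))) :: 'p mod_ring)
          = 0"
        using mod_ring_Lucas[OF assms(1), of "h + y + 1" h a x]
        unfolding p_def[symmetric] by (simp add: binomial_eq_0)
      ultimately show ?thesis using False by simp
    qed
  qed
  finally show ?case unfolding half(3)[symmetric] unfolding p_def .
qed simp

text \<open>One exponent \<open>N\<close> serves every index below \<open>p ^ N\<close>. Negative
  \<open>z\<close> are included, as \<open>z div 2\<close> is then negative and
  \<open>zchoose\<close> is \<open>0\<close>.\<close>

lemma extend_zero_cantor_seq: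
  assumes "prime CARD('p::prime_card)" "odd CARD('p)" "z < int CARD('p) ^ N"
  shows "(extend_zero cantor_seq z :: 'p mod_ring) =
    (if even z then of_int (zchoose ((CARD('p) ^ N - 1) div 2) (z div 2)) else 0)"
proof (cases "z < 0")
  case True
  then show ?thesis by (simp add: extend_zero_def zchoose_def)
next
  case False
  then obtain i where i: "z = int i" using nonneg_int_cases by (metis not_less)
  then have "i < CARD('p) ^ N" using assms(3) by (simp flip: of_nat_power)
  with i show ?thesis
    using cantor_seq_eq[OF assms(2), of i N] nth_cantor_pow[OF assms(1,2), of i N]
    by (simp add: extend_zero_def zchoose_def nat_div_distrib)
qed


section \<open>Checkerboard determinants\<close>

lemma det_reindex:
  fixes A :: "nat \<Rightarrow> nat \<Rightarrow> 'a :: comm_ring_1"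
  assumes "\<pi> permutes {0..<n}"
  shows "det (mat n n (\<lambda>(i, j). A (\<pi> i) j)) = signof \<pi> * det (mat n n (\<lambda>(i, j). A i j))"
    and "det (mat n n (\<lambda>(i, j). A (\<pi> i) (\<pi> j))) = det (mat n n (\<lambda>(i, j). A i j))"
proof -
  have rows: "det (mat n n (\<lambda>(i, j). B (\<pi> i) j)) = signof \<pi> * det (mat n n (\<lambda>(i, j). B i j))"
    for B :: "nat \<Rightarrow> nat \<Rightarrow> 'a"
  proof -
    have "mat n n (\<lambda>(i, j). mat n n (\<lambda>(i, j). B i j) $$ (\<pi> i, j)) = mat n n (\<lambda>(i, j). B (\<pi> i) j)"
      using permutes_in_image[OF assms] by (intro eq_matI) auto
    with det_permute_rows[OF mat_carrier assms, of "\<lambda>(i, j). B i j"] show ?thesis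
      by (simp only:)
  qed
  have transpose: "det (mat n n (\<lambda>(i, j). B j i)) = det (mat n n (\<lambda>(i, j). B i j))"
    for B :: "nat \<Rightarrow> nat \<Rightarrow> 'a"
  proof -
    have "mat n n (\<lambda>(i, j). B j i) = transpose_mat (mat n n (\<lambda>(i, j). B i j))"
      by (intro eq_matI) auto
    then show ?thesis using det_transpose[OF mat_carrier, of n "\<lambda>(i, j). B i j"] by (simp only:)
  qed
  show "det (mat n n (\<lambda>(i, j). A (\<pi> i) j)) = signof \<pi> * det (mat n n (\<lambda>(i, j). A i j))"
    by (rule rows[of A])
  have "det (mat n n (\<lambda>(i, j). A (\<pi> i) (\<pi> j))) = signof \<pi> * det (mat n n (\<lambda>(i, j). A i (\<pi> j)))"
    by (rule rows[of "\<lambda>i j. A i (\<pi> j)"])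
  also have "det (mat n n (\<lambda>(i, j). A i (\<pi> j))) = det (mat n n (\<lambda>(i, j). A j (\<pi> i)))"
    by (rule transpose[of "\<lambda>i j. A i (\<pi> j)", symmetric])
  also have "\<dots> = signof \<pi> * det (mat n n (\<lambda>(i, j). A j i))"
    by (rule rows[of "\<lambda>i j. A j i"])
  also have "det (mat n n (\<lambda>(i, j). A j i)) = det (mat n n (\<lambda>(i, j). A i j))"
    by (rule transpose[of A])
  also have "signof \<pi> * (signof \<pi>
      * det (mat n n (\<lambda>(i, j). A i j))) = det (mat n n (\<lambda>(i, j). A i j))"
    by (simp add: sign_def)
  finally show "det (mat n n (\<lambda>(i, j). A (\<pi> i) (\<pi> j))) = det (mat n n (\<lambda>(i, j). A i j))" .
qed

text \<open>Listing the even indices before the odd ones makes the matrix block diagonal. Rows and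
  columns are permuted alike, so the two signs cancel.\<close>

lemma det_even_checkerboard:
  fixes A :: "nat \<Rightarrow> nat \<Rightarrow> 'a :: idom"
  assumes "\<And>i j. odd (i + j) \<Longrightarrow> A i j = 0"
  shows "det (mat n n (\<lambda>(i, j). A i j)) =
    det (mat ((n + 1) div 2) ((n + 1) div 2) (\<lambda>(i, j). A (2 * i) (2 * j))) *
    det (mat (n div 2) (n div 2) (\<lambda>(i, j). A (2 * i + 1) (2 * j + 1)))"
proof -
  define c where "c = (n + 1) div 2"
  define d where "d = n div 2"
  have n: "n = c + d" by (simp add: c_def d_def)
  define \<pi> where "\<pi> i = (if i < c then 2 * i else if i < n then 2 * (i - c) + 1 else i)" for i
  have "inj_on \<pi> {0..<n}"
    unfolding inj_on_def \<pi>_def by (auto split: if_splits) presburger+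
  moreover have "\<pi> ` {0..<n} \<subseteq> {0..<n}"
    by (auto simp: \<pi>_def c_def)
  ultimately have "bij_betw \<pi> {0..<n} {0..<n}"
    by (simp add: bij_betw_def endo_inj_surj)
  then have perm: "\<pi> permutes {0..<n}"
    by (rule bij_imp_permutes) (auto simp: \<pi>_def n)
  have "mat n n (\<lambda>(i, j). A (\<pi> i) (\<pi> j)) =
      four_block_mat (mat c c (\<lambda>(i, j). A (2 * i) (2 * j))) (0\<^sub>m c d) (0\<^sub>m d c)
        (mat d d (\<lambda>(i, j). A (2 * i + 1) (2 * j + 1)))"
    using assms by (intro eq_matI) (auto simp: n \<pi>_def)
  then have "det (mat n n (\<lambda>(i, j). A (\<pi> i) (\<pi> j))) =
      det (mat c c (\<lambda>(i, j). A (2 * i) (2 * j)))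
          * det (mat d d (\<lambda>(i, j). A (2 * i + 1) (2 * j + 1)))"
    by (simp add: det_four_block_mat_upper_right_zero[of _ c _ d])
  then show ?thesis
    unfolding det_reindex(2)[OF perm] c_def d_def .
qed

text \<open>Exchanging rows \<open>2 * i\<close> and \<open>2 * i + 1\<close> reduces to the even
  checkerboard; the sign does not affect vanishing.\<close>

lemma det_odd_checkerboard:
  fixes A :: "nat \<Rightarrow> nat \<Rightarrow> 'a :: idom"
  assumes "\<And>i j. even (i + j) \<Longrightarrow> A i j = 0"
  shows "det (mat (2 * k) (2 * k) (\<lambda>(i, j). A i j)) = 0 \<longleftrightarrow>
    det (mat k k (\<lambda>(i, j). A (2 * i + 1) (2 * j))) = 0 \<or>
    det (mat k k (\<lambda>(i, j). A (2 * i) (2 * j + 1))) = 0"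
proof -
  define \<pi> where "\<pi> i = (if i < 2 * k then if even i then i + 1 else i - 1 else i)" for i :: nat
  have "\<pi> (\<pi> i) = i" for i by (auto simp: \<pi>_def)
  moreover have "\<pi> i < 2 * k" if "i < 2 * k" for i
    using that by (auto simp: \<pi>_def)
  ultimately have "bij_betw \<pi> {0..<2 * k} {0..<2 * k}"
    by (intro bij_betwI[where g = \<pi>]) auto
  then have perm: "\<pi> permutes {0..<2 * k}"
    by (rule bij_imp_permutes) (auto simp: \<pi>_def)
  define B where "B i j = (if even i then A (i + 1) j else A (i - 1) j)" for i j
  have "mat (2 * k) (2 * k) (\<lambda>(i, j). A (\<pi> i) j) = mat (2 * k) (2 * k) (\<lambda>(i, j). B i j)"
    by (intro eq_matI) (auto simp: \<pi>_def B_def)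
  then have "signof \<pi> * det (mat (2 * k) (2 * k) (\<lambda>(i, j). A i j)) =
      det (mat (2 * k) (2 * k) (\<lambda>(i, j). B i j))"
    using det_reindex(1)[OF perm, of A] by simp
  also have "\<dots> = det (mat k k (\<lambda>(i, j). B (2 * i) (2 * j)))
      * det (mat k k (\<lambda>(i, j). B (2 * i + 1) (2 * j + 1)))"
    using assms by (subst det_even_checkerboard) (auto simp: B_def)
  also have "mat k k (\<lambda>(i, j). B (2 * i) (2 * j)) = mat k k (\<lambda>(i, j). A (2 * i + 1) (2 * j))"
    by (simp add: B_def)
  also have "mat k k (\<lambda>(i, j). B (2 * i + 1) (2 * j + 1))
      = mat k k (\<lambda>(i, j). A (2 * i) (2 * j + 1))"
    by (simp add: B_def)
  finally have "signof \<pi> * det (mat (2 * k) (2 * k) (\<lambda>(i, j). A i j)) = 0 \<longleftrightarrow>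
      det (mat k k (\<lambda>(i, j). A (2 * i + 1) (2 * j))) = 0 \<or>
      det (mat k k (\<lambda>(i, j). A (2 * i) (2 * j + 1))) = 0"
    by (simp only: mult_eq_0_iff)
  moreover have "signof \<pi> \<noteq> (0 :: 'a)" by (simp add: sign_def)
  ultimately show ?thesis by (simp only: mult_eq_0_iff) simp
qed

text \<open>Scaling row \<open>i\<close> by \<open>(- 1) ^ i\<close> and column \<open>j\<close> by
  \<open>(- 1) ^ j\<close> keeps the determinant but negates every entry, which for odd order
  negates the determinant.\<close>

lemma det_odd_checkerboard_zero:
  fixes A :: "nat \<Rightarrow> nat \<Rightarrow> 'a :: idom"
  assumes "\<And>i j. even (i + j) \<Longrightarrow> A i j = 0" "odd n" "(2 :: 'a) \<noteq> 0"
  shows "det (mat n n (\<lambda>(i, j). A i j)) = 0"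
proof -
  let ?D = "det (mat n n (\<lambda>(i, j). A i j))"
  let ?S = "\<Prod>i<n. (- 1) ^ i :: 'a"
  have "?S * ?S = 1"
    by (simp flip: prod.distrib power_mult_distrib)
  then have "?D = ?S * (?S * ?D)"
    by (simp only: mult.assoc[symmetric] mult_1)
  also have "\<dots> = det (mat n n (\<lambda>(i, j). (- 1) ^ i * ((- 1) ^ j * A i j)))"
    unfolding det_scale_rows[of n "\<lambda>i. (- 1) ^ i" "\<lambda>i j. (- 1) ^ j * A i j"]
      det_scale_columns[of n "\<lambda>j. (- 1) ^ j" A] ..
  also have "mat n n (\<lambda>(i, j). (- 1) ^ i * ((- 1) ^ j * A i j)) = mat n n (\<lambda>(i, j). - 1 * A i j)"
  proof -
    have "(- 1) ^ i * ((- 1) ^ j * A i j) = - 1 * A i j" for i j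
      using assms(1)[of i j] by (cases "even i"; cases "even j") auto
    then show ?thesis by (simp only:)
  qed
  also have "det \<dots> = - ?D"
    using det_scale_rows[of n "\<lambda>_. - 1" A] assms(2) by simp
  finally have "2 * ?D = 0" by (metis add.right_inverse mult_2)
  with assms(3) show ?thesis by simp
qed


section \<open>The number wall of the Cantor sequence\<close>

text \<open>The condition has period \<open>2 * q\<close> in both coordinates, as it involves
  remainders and the parities of quotients.\<close>

lemma vanishing_add_double:
  assumes "x < 2 * q" "y < 2 * q"
  shows "vanishing q (2 * q * M + x) (2 * q * K + y) \<longleftrightarrow> x < q \<and> q \<le> y \<or>
    q < x \<and> x < 2 * q - 1 \<and> 0 < y \<and> y < q - 1"
proof -
  have "q > 0" using assms by (cases q) auto
  then have small: "(2 * q * M + x) div q = 2 * M" "(2 * q * M + x) mod q = x" if "x < q" for M x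
    using that by (simp_all add: mult.assoc mult.left_commute[of 2])
  have large: "(2 * q * M + x) div q = 2 * M + 1" "(2 * q * M + x) mod q = x - q"
    if "q \<le> x" "x < 2 * q" for M x
  proof -
    obtain z where z: "x = q + z" "z < q"
      using \<open>q \<le> x\<close> \<open>x < 2 * q\<close> le_Suc_ex[of q x] by auto
    have eq: "2 * q * M + x = z + (2 * M + 1) * q"
      unfolding z(1) by (simp add: distrib_right)
    show "(2 * q * M + x) div q = 2 * M + 1"
      unfolding eq using z by (subst div_mult_self1) auto
    show "(2 * q * M + x) mod q = x - q"
      unfolding eq using z by (subst mod_mult_self1) auto
  qed
  show ?thesis
    unfolding vanishing_def using assms
    by (cases "x < q"; cases "y < q") (auto simp: small large not_less)
qed

text \<open>The two sizes are those of the diagonal blocks of a wall determinant of order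
  \<open>m + 1\<close>. Both sides depend only on \<open>m\<close> modulo \<open>2 * q\<close> and
  \<open>r\<close> modulo \<open>q\<close>, so inequalities between residues remain.\<close>

lemma vanishing_even_iff:
  assumes "odd q"
  shows "vanishing q m (2 * r) \<longleftrightarrow>
    excessive q ((m + 2) div 2) r \<or> excessive q ((m + 1) div 2) r"
proof -
  obtain h where h: "q = 2 * h + 1" using assms by (elim oddE)
  define l x y where "l = m div 2" "x = l mod q" "y = r mod q"
  note defs = this
  have xy: "x < q" "y < q" using h by (simp_all add: defs)
  have l: "l = q * (l div q) + x" and "r = q * (r div q) + y"
    by (simp_all add: defs)
  then have r2: "2 * r = 2 * q * (r div q) + 2 * y" by linarith
  have half: "(q - 1) div 2 = h" using h by simp
  have Suc: "Suc l mod q = (if Suc x = q then 0 else Suc x)" by (simp add: defs mod_Suc)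
  show ?thesis
  proof (cases "even m")
    case True
    then have m: "m = 2 * q * (l div q) + 2 * x" "(m + 2) div 2 = Suc l" "(m + 1) div 2 = l"
      using l by (auto simp: defs(1) elim!: evenE)
    have "vanishing q m (2 * r) \<longleftrightarrow> 2 * x < q \<and> q \<le> 2 * y \<or>
        q < 2 * x \<and> 2 * x < 2 * q - 1 \<and> 0 < 2 * y \<and> 2 * y < q - 1"
      unfolding r2 m(1) using xy by (intro vanishing_add_double) auto
    then show ?thesis
      unfolding m(2,3) excessive_def Suc defs(2,3)[symmetric] half using xy h by auto
  next
    case False
    then have m: "m = 2 * q * (l div q) + (2 * x + 1)" "(m + 2) div 2 = Suc l"
        "(m + 1) div 2 = Suc l"
      using l by (auto simp: defs(1) elim!: oddE)
    have "vanishing q m (2 * r) \<longleftrightarrow> 2 * x + 1 < q \<and> q \<le> 2 * y \<or>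
        q < 2 * x + 1 \<and> 2 * x + 1 < 2 * q - 1 \<and> 0 < 2 * y \<and> 2 * y < q - 1"
      unfolding r2 m(1) using xy by (intro vanishing_add_double) auto
    then show ?thesis
      unfolding m(2,3) excessive_def Suc defs(2,3)[symmetric] half using xy h by auto
  qed
qed

text \<open>For odd row and column the two blocks of the wall determinant have equal order
  \<open>Suc l\<close>, with shifts \<open>r\<close> and \<open>Suc r\<close>.\<close>

lemma vanishing_odd_iff:
  assumes "odd q"
  shows "vanishing q (2 * l + 1) (2 * r + 1) \<longleftrightarrow>
    excessive q (Suc l) r \<or> excessive q (Suc l) (Suc r)"
proof -
  obtain h where h: "q = 2 * h + 1" using assms by (elim oddE)
  define x y where "x = l mod q" "y = r mod q"
  note defs = this
  have xy: "x < q" "y < q" using h by (simp_all add: defs)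
  have "l = q * (l div q) + x" "r = q * (r div q) + y"
    by (simp_all add: defs)
  then have eq: "2 * l + 1 = 2 * q * (l div q) + (2 * x + 1)"
      "2 * r + 1 = 2 * q * (r div q) + (2 * y + 1)"
    by linarith+
  have half: "(q - 1) div 2 = h" using h by simp
  have Suc: "Suc l mod q = (if Suc x = q then 0 else Suc x)"
      "Suc r mod q = (if Suc y = q then 0 else Suc y)"
    by (simp_all add: defs mod_Suc)
  have "vanishing q (2 * l + 1) (2 * r + 1) \<longleftrightarrow> 2 * x + 1 < q \<and> q \<le> 2 * y + 1 \<or>
      q < 2 * x + 1 \<and> 2 * x + 1 < 2 * q - 1 \<and> 0 < 2 * y + 1 \<and> 2 * y + 1 < q - 1"
    unfolding eq using xy by (intro vanishing_add_double) auto
  then show ?thesis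
    unfolding excessive_def Suc defs[symmetric] half using xy h by auto
qed

section \<open>Vanishing of the wall entries\<close>

lemma det_mod_ring_binomial_toeplitz_eq_0_iff:
  assumes "prime CARD('p::prime_card)" "odd CARD('p)" "r + k \<le> (CARD('p) ^ N - 1) div 2"
  shows "det (mat k k (\<lambda>(i, j).
      of_int (zchoose ((CARD('p) ^ N - 1) div 2) (int r + int i - int j)) :: 'p mod_ring)) = 0 \<longleftrightarrow>
    (\<exists>t<N. excessive (CARD('p) ^ t) k r)"
proof -
  let ?p = "CARD('p)"
  let ?M = "binomial_toeplitz ((?p ^ N - 1) div 2) k r"
  have "mat k k (\<lambda>(i, j). of_int (zchoose ((?p ^ N - 1) div 2) (int r + int i - int j))) =
      (map_mat of_int ?M :: 'p mod_ring mat)"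
    by (intro eq_matI) (auto simp: binomial_toeplitz_def)
  then have "det (mat k k (\<lambda>(i, j).
      of_int (zchoose ((?p ^ N - 1) div 2) (int r + int i - int j)) :: 'p mod_ring)) =
      of_int (det ?M)"
    by (simp only: of_int_hom.hom_det)
  also have "\<dots> = 0 \<longleftrightarrow> int ?p dvd det ?M"
    by (simp add: of_int_eq_0_iff_char_dvd)
  also have "\<dots> \<longleftrightarrow> (\<exists>t\<in>{1..N}. excessive (?p ^ t) k r)"
    by (rule prime_dvd_det_binomial_toeplitz_iff[OF assms])
  also have "\<dots> \<longleftrightarrow> (\<exists>t<N. excessive (?p ^ t) k r)"
  proof -
    \<comment> \<open>At scale \<open>p ^ N\<close> both residues are at most
      \<open>(p ^ N - 1) div 2\<close>, which neither case of \<open>excessive\<close> allows. With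
      scale \<open>1\<close> excluded too, the range of \<open>t\<close> becomes that of the
      array.\<close>
    have "\<not> excessive (?p ^ N) k r"
      using assms(3) unfolding excessive_def by auto
    moreover have "\<not> excessive (?p ^ 0) k r"
      by (simp add: excessive_def)
    ultimately have "t \<in> {1..N} \<longleftrightarrow> t < N" if "excessive (?p ^ t) k r" for t
      using that by (cases "t = 0"; cases "t = N") auto
    then show ?thesis by blast
  qed
  finally show ?thesis .
qed

text \<open>Entries with odd index \<open>i - j + n\<close> are zero, so the matrix is a
  checkerboard whose colour depends on the parity of \<open>n\<close>. For odd \<open>n\<close> the
  order \<open>m + 1\<close> decides between a splitting and an identically zero
  determinant.\<close>

lemma number_wall_cantor_eq_0_iff:
  assumes "prime CARD('p::prime_card)" "odd CARD('p)" "m + n + 2 \<le> (CARD('p) ^ N - 1) div 2"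
  shows "number_wall (extend_zero cantor_seq :: int \<Rightarrow> 'p mod_ring) (int m) (int n) = 0 \<longleftrightarrow>
    (\<exists>t<N. vanishing (CARD('p) ^ t) m n)"
proof -
  let ?p = "CARD('p)"
  define a where "a = (?p ^ N - 1) div 2"
  define A :: "nat \<Rightarrow> nat \<Rightarrow> 'p mod_ring" where "A i j =
    (if even (int i - int j + int n) then of_int (zchoose a ((int i - int j + int n) div 2)) else 0)" for i j
  have "N > 0" using assms(3) by (cases N) auto
  have odd: "odd (?p ^ t)" for t using assms(2) by simp
  have "int (m + n + 2) \<le> int ((?p ^ N - 1) div 2)" using assms(3) by (simp only: of_nat_le_iff)
  then have bound: "int i - int j + int n < int ?p ^ N" if "i < m + 1" for i j
    using that by (simp add: of_nat_diff zdiv_int flip: of_nat_power)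
  have "number_wall (extend_zero cantor_seq :: int \<Rightarrow> 'p mod_ring) (int m) (int n) =
      det (mat (m + 1) (m + 1) (\<lambda>(i, j). extend_zero cantor_seq (int i - int j + int n)))"
    by (simp add: number_wall_def nat_add_distrib)
  also have "mat (m + 1) (m + 1) (\<lambda>(i, j). extend_zero cantor_seq (int i - int j + int n)) =
      mat (m + 1) (m + 1) (\<lambda>(i, j). A i j)"
    using extend_zero_cantor_seq[OF assms(1,2) bound]
    by (intro eq_matI) (simp_all only: A_def a_def dim_row_mat dim_col_mat index_mat split_conv)
  finally have W: "number_wall (extend_zero cantor_seq :: int \<Rightarrow> 'p mod_ring) (int m) (int n) =
      det (mat (m + 1) (m + 1) (\<lambda>(i, j). A i j))" .
  note toeplitz = det_mod_ring_binomial_toeplitz_eq_0_iff[OF assms(1,2), where N = N, folded a_def]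
  consider r where "n = 2 * r" | r l where "n = 2 * r + 1" "m = 2 * l + 1" | "odd n" "even m"
    by (metis oddE evenE)
  then show ?thesis
  proof cases
    case 1
    have "A (2 * i) (2 * j) = of_int (zchoose a (int r + int i - int j))"
      "A (2 * i + 1) (2 * j + 1) = of_int (zchoose a (int r + int i - int j))" for i j
    proof -
      have double: "int (2 * i) - int (2 * j) + int n = 2 * (int r + int i - int j)"
        "int (2 * i + 1) - int (2 * j + 1) + int n = 2 * (int r + int i - int j)"
        "even (2 * x)" "2 * x div 2 = x" for x :: int
        using 1 by simp_all
      show "A (2 * i) (2 * j) = of_int (zchoose a (int r + int i - int j))"
        "A (2 * i + 1) (2 * j + 1) = of_int (zchoose a (int r + int i - int j))"
        by (simp_all only: A_def double if_True)
    qed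
    note A = this
    have "A i j = 0" if "odd (i + j)" for i j
      using that 1 by (simp add: A_def)
    then have split: "det (mat (m + 1) (m + 1) (\<lambda>(i, j). A i j)) =
      det (mat ((m + 1 + 1) div 2) ((m + 1 + 1) div 2)
        (\<lambda>(i, j). of_int (zchoose a (int r + int i - int j)))) *
      det (mat ((m + 1) div 2) ((m + 1) div 2)
        (\<lambda>(i, j). of_int (zchoose a (int r + int i - int j))))"
      using det_even_checkerboard[of A "m + 1", unfolded A] by blast
    have "r + (m + 1 + 1) div 2 \<le> a" "r + (m + 1) div 2 \<le> a"
      using assms(3) 1 unfolding a_def[symmetric] by linarith+
    note toeplitz = toeplitz[OF this(1)] toeplitz[OF this(2)]
    have "number_wall (extend_zero cantor_seq :: int \<Rightarrow> 'p mod_ring) (int m) (int n) = 0 \<longleftrightarrow>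
      (\<exists>t<N. excessive (?p ^ t) ((m + 1 + 1) div 2) r)
          \<or> (\<exists>t<N. excessive (?p ^ t) ((m + 1) div 2) r)"
      unfolding W split mult_eq_0_iff toeplitz ..
    moreover have "m + 1 + 1 = m + 2" by simp
    ultimately have "number_wall (extend_zero cantor_seq :: int \<Rightarrow> 'p mod_ring) (int m) (int n) = 0 \<longleftrightarrow>
      (\<exists>t<N. excessive (?p ^ t) ((m + 2) div 2) r) \<or> (\<exists>t<N. excessive (?p ^ t) ((m + 1) div 2) r)"
      by (simp only:)
    then show ?thesis
      using vanishing_even_iff[OF odd] 1 by blast
  next
    case 2
    have "A (2 * i + 1) (2 * j) = of_int (zchoose a (int (Suc r) + int i - int j))"
      "A (2 * i) (2 * j + 1) = of_int (zchoose a (int r + int i - int j))" for i j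
    proof -
      have double: "int (2 * i + 1) - int (2 * j) + int n = 2 * (int (Suc r) + int i - int j)"
        "int (2 * i) - int (2 * j + 1) + int n = 2 * (int r + int i - int j)"
        "even (2 * x)" "2 * x div 2 = x" for x :: int
        using 2 by simp_all
      show "A (2 * i + 1) (2 * j) = of_int (zchoose a (int (Suc r) + int i - int j))"
        "A (2 * i) (2 * j + 1) = of_int (zchoose a (int r + int i - int j))"
        by (simp_all only: A_def double if_True)
    qed
    note A = this
    have "A i j = 0" if "even (i + j)" for i j
      using that 2 by (simp add: A_def)
    then have split: "det (mat (2 * Suc l) (2 * Suc l) (\<lambda>(i, j). A i j)) = 0 \<longleftrightarrow>
      det (mat (Suc l) (Suc l)
        (\<lambda>(i, j). of_int (zchoose a (int (Suc r) + int i - int j)) :: 'p mod_ring)) = 0 \<or>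
      det (mat (Suc l) (Suc l)
        (\<lambda>(i, j). of_int (zchoose a (int r + int i - int j)) :: 'p mod_ring)) = 0"
      using det_odd_checkerboard[of A "Suc l", unfolded A] by blast
    have size: "m + 1 = 2 * Suc l" using 2 by simp
    have "Suc r + Suc l \<le> a" "r + Suc l \<le> a"
      using assms(3) 2 unfolding a_def[symmetric] by linarith+
    note toeplitz = toeplitz[OF this(1)] toeplitz[OF this(2)]
    have "number_wall (extend_zero cantor_seq :: int \<Rightarrow> 'p mod_ring) (int m) (int n) = 0 \<longleftrightarrow>
      (\<exists>t<N. excessive (?p ^ t) (Suc l) (Suc r)) \<or> (\<exists>t<N. excessive (?p ^ t) (Suc l) r)"
      unfolding W size split toeplitz ..
    then show ?thesis
      using vanishing_odd_iff[OF odd] 2 by blast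
  next
    case 3
    have "(2 :: 'p mod_ring) \<noteq> 0"
    proof
      assume "(2 :: 'p mod_ring) = 0"
      then have "of_nat 2 = (0 :: 'p mod_ring)" by simp
      then have "?p dvd 2" by (simp only: of_nat_eq_0_iff_char_dvd semiring_char_mod_ring)
      then have "?p = 2"
        using assms(1) two_is_prime_nat by (simp only: primes_dvd_imp_eq)
      with assms(2) show False by simp
    qed
    then have "det (mat (m + 1) (m + 1) (\<lambda>(i, j). A i j)) = 0"
      using 3 by (intro det_odd_checkerboard_zero) (auto simp: A_def)
    \<comment> \<open>These zeros belong to scale \<open>t = 0\<close>, where blocks are single
      cells.\<close>
    moreover have "vanishing (?p ^ 0) m n"
      using 3 by (simp add: vanishing_def)
    ultimately show ?thesis using W \<open>N > 0\<close> by metis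
  qed
qed

theorem theorem5p1:
  fixes p :: nat
    and W :: "int \<Rightarrow> int \<Rightarrow> 'p::prime_card mod_ring"
  assumes "CARD('p) = p"
    and "prime p"
    and "odd p"
    and "W = number_wall (extend_zero cantor_seq)"
  shows "(\<lambda>m n :: nat. profile W (int m) (int n)) = Pi_array (Phi_limit p LA)"
proof (intro ext)
  fix m n :: nat
  \<comment> \<open>Twice \<open>m + n + 3\<close>, so that \<open>N < p ^ N\<close> yields the
    bound on \<open>m + n + 2\<close> after halving.\<close>
  define N where "N = 2 * (m + n + 3)"
  have "p > 1" using assms(2) by (rule prime_gt_1_nat)
  then have "2 ^ N \<le> p ^ N" by (intro power_mono) auto
  then have N: "N < p ^ N" using less_exp[of N] by linarith
  then have lt: "m < p ^ N" "n < p ^ N" "m + n + 2 \<le> (p ^ N - 1) div 2"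
    by (auto simp: N_def)
  have "W (int m) (int n) = 0 \<longleftrightarrow> Phi_limit p LA m n = L0"
    using number_wall_cantor_eq_0_iff[where 'p = 'p, of m n N] assms lt
      Phi_limit_eq_L0_iff[OF assms(3) \<open>p > 1\<close> lt(1,2)] by simp
  moreover have "Pi_letter L = (if L = L0 then Zero else X)" for L
    by (cases L) simp_all
  ultimately show "profile W (int m) (int n) = Pi_array (Phi_limit p LA) m n"
    by (simp add: profile_def Pi_array_def)
qed

end
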